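(* Suppose that $(X,d,\mu)$ is a totally bounded metric measure space and $\mu$ is lower Ahlfors $Q(\cdot)$-regular for some $Q\in\mathcal{P}_b^{\log}(X)$. Fix $q\in\mathcal{P}(X)$ and $p,s\in\mathcal{P}_b^{\log}(X)$ such that $sp\ll Q$. Then the following statements are true. (i) For every $\beta\in\mathcal{P}_b(X)$ we have the compact embedding $$M^{s(\cdot)}_{p(\cdot),q(\cdot)}(X,d,\mu)\hookrightarrow\hookrightarrow L^{\beta(\cdot)}(X,\mu)$$ if $p\le\beta\ll\gamma$, where $\gamma:=Qp/(Q-sp)$. (ii) If $q\le p$, then for every $\beta\in\mathcal{P}_b(X)$ we have the compact embedding $$N^{s(\cdot)}_{p(\cdot),q(\cdot)}(X,d,\mu)\hookrightarrow\hookrightarrow L^{\beta(\cdot)}(X,\mu)$$ if $p\le\beta\ll\gamma$, where $\gamma:=Qp/(Q-sp)$. (iii) For every $\beta\in\mathcal{P}_b(X)$ and $t\in\mathcal{P}_b^{\log}(X)$ such that $t\ll s$ we have the compact embedding $$N^{s(\cdot)}_{p(\cdot),q(\cdot)}(X,d,\mu)\hookrightarrow\hookrightarrow L^{\beta(\cdot)}(X,\mu)$$ if $p\le\beta\ll\sigma$, where $\sigma:=Qp/(Q-tp)$.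
   Context: A metric measure space $(X,d,\mu)$ is a metric space $(X,d)$ with a Borel measure $\mu$ such that $0<\mu(B(x,r))<\infty$ for every open ball $B(x,r)$, $x\in X$, $r\in(0,\infty)$ (in particular $X$ is separable). Exponents: for measurable $p$ on $X$, $p^+=\operatorname{ess\,sup}_X p$, $p^-=\operatorname{ess\,inf}_X p$. $\mathcal{P}(X)$ is the set of measurable $p:X\to(0,\infty]$ with $p^->0$; $\mathcal{P}_b(X)=\mathcal{P}(X)\cap L^\infty(X,\mu)$. $p_1\ll p_2$ means $(p_2-p_1)^->0$. $\mathcal{P}_b^{\log}(X)$ is the set of $p\in\mathcal{P}_b(X)$ such that $1/p$ is locally log-Hölder continuous: there is $C\in(0,\infty)$ with $|1/p(x)-1/p(y)|\le C/\log(e+1/d(x,y))$ for all $x,y\in X$. $\mu$ is lower Ahlfors $Q(\cdot)$-regular if there is $b_1\in(0,\infty)$ such that $\mu(B(x,r))\ge b_1r^{Q(x)}$ for all $x\in X$, $r\in(0,1]$. Lebesgue spaces: for $p\in\mathcal{P}_b(X)$ let $\rho_{p(\cdot)}(u)=\int_X|u(x)|^{p(x)}\,d\mu(x)$. $L^{p(\cdot)}(X,\mu)$ is the space of measurable $u$ with $\rho_{p(\cdot)}(\lambda u)<\infty$ for some $\lambda>0$, with quasi-norm $\|u\|_{L^{p(\cdot)}}=\inf\{\lambda>0:\rho_{p(\cdot)}(u/\lambda)\le1\}$. Mixed spaces ($p\in\mathcal{P}_b(X)$, $q\in\mathcal{P}(X)$): for sequences $\{u_k\}_{k\in\mathbb{Z}}$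 of measurable functions, $\|\{u_k\}\|_{L^{p(\cdot)}(\ell^{q(\cdot)})}=\big\|\,\|\{u_k(\cdot)\}_k\|_{\ell^{q(\cdot)}}\big\|_{L^{p(\cdot)}}$ (pointwise $\ell^{q(x)}(\mathbb{Z})$ quasi-norm, supremum if $q(x)=\infty$). Let $\rho_{\ell^{q(\cdot)}(L^{p(\cdot)})}(\{u_k\})=\sum_{k\in\mathbb{Z}}\inf\{\lambda_k>0:\rho_{p(\cdot)}(u_k/\lambda_k^{1/q(\cdot)})\le1\}$ (with $\lambda^{1/\infty}=1$) and $\|\{u_k\}\|_{\ell^{q(\cdot)}(L^{p(\cdot)})}=\inf\{m>0:\rho_{\ell^{q(\cdot)}(L^{p(\cdot)})}(\{u_k\}/m)\le1\}$. Gradients: let $s\in\mathcal{P}_b(X)$ and $u:X\to\overline{\mathbb{R}}$ be measurable and finite a.e. A sequence $\{g_k\}_{k\in\mathbb{Z}}$ of non-negative measurable functions is a vector $s(\cdot)$-gradient of $u$ (written $\{g_k\}\in\mathbb{D}^{s(\cdot)}(u)$) if there is a $\mu$-null set $N_u$ such that $|u(x)-u(y)|\le d(x,y)^{s(x)}g_k(x)+d(x,y)^{s(y)}g_k(y)$ for all $k\in\mathbb{Z}$ and all $x,y\in X\setminus N_u$ with $2^{-k-1}\le d(x,y)<2^{-k}$. Function spaces: $\|u\|_{\dot M^{s(\cdot)}_{p(\cdot),q(\cdot)}}=\inf_{g\in\mathbb{D}^{s(\cdot)}(u)}\|g\|_{L^{p(\cdot)}(\ell^{q(\cdot)})}$ and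 $\|u\|_{\dot N^{s(\cdot)}_{p(\cdot),q(\cdot)}}=\inf_{g\in\mathbb{D}^{s(\cdot)}(u)}\|g\|_{\ell^{q(\cdot)}(L^{p(\cdot)})}$. For $A\in\{M,N\}$, $A^{s(\cdot)}_{p(\cdot),q(\cdot)}(X,d,\mu)$ is the space of $u\in L^{p(\cdot)}(X,\mu)$ with $\|u\|_{\dot A^{s(\cdot)}_{p(\cdot),q(\cdot)}}<\infty$, with quasi-norm $\|u\|_{L^{p(\cdot)}}+\|u\|_{\dot A^{s(\cdot)}_{p(\cdot),q(\cdot)}}$. $Y\hookrightarrow\hookrightarrow Z$ (compact embedding) means $Y\subseteq Z$ with continuous inclusion mapping bounded subsets of $Y$ to totally bounded subsets of $Z$. *)

theory Defs
  imports "HOL-Analysis.Analysis" "HOL-Probability.Essential_Supremum"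
begin

definition metric_measure_space :: "'a::metric_space measure \<Rightarrow> bool" where
  "metric_measure_space M \<longleftrightarrow>
     sets M = sets borel \<and>
     (\<forall>x r. 0 < r \<longrightarrow> 0 < emeasure M (ball x r) \<and> emeasure M (ball x r) < \<infinity>)"


section \<open>Variable exponents\<close>

text \<open>
  Exponents are \<^typ>\<open>ereal\<close>-valued: they may be infinite, and differences of exponents are
  formed to compare them.
\<close>

definition essinf :: "'a measure \<Rightarrow> ('a \<Rightarrow> ereal) \<Rightarrow> ereal" where
  "essinf M f = - esssup M (\<lambda>x. - f x)"

definition exponents :: "'a measure \<Rightarrow> ('a \<Rightarrow> ereal) set" where
  "exponents M = {p \<in> borel_measurable M. (\<forall>x\<in>space M. 0 < p x) \<and> 0 < essinf M p}"

text \<open>A bounded exponent is only essentially bounded; it may be infinite on a null set.\<close>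

definition bounded_exponents :: "'a measure \<Rightarrow> ('a \<Rightarrow> ereal) set" where
  "bounded_exponents M = {p \<in> exponents M. esssup M p < \<infinity>}"

definition log_exponents :: "'a::metric_space measure \<Rightarrow> ('a \<Rightarrow> ereal) set" where
  "log_exponents M = {p \<in> bounded_exponents M. \<exists>C>0. \<forall>x y.
     \<bar>1 / p x - 1 / p y\<bar> \<le> ereal (C / ln (exp 1 + 1 / dist x y))}"

definition ess_less :: "'a measure \<Rightarrow> ('a \<Rightarrow> ereal) \<Rightarrow> ('a \<Rightarrow> ereal) \<Rightarrow> bool" where
  "ess_less M p1 p2 \<longleftrightarrow> 0 < essinf M (\<lambda>x. p2 x - p1 x)"

text \<open>
  The power \<open>a\<^sup>r\<close> for \<open>a \<in> [0, \<infinity>]\<close> and \<open>r \<in> (0, \<infinity>]\<close>, and also for \<open>a \<in> (0, \<infinity>)\<close> and \<open>r = 0\<close>,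
  where it is 1; the latter gives \<open>l\<^bsup>1/\<infinity>\<^esup> = 1\<close>.
\<close>

definition epow :: "ereal \<Rightarrow> ereal \<Rightarrow> ereal" where
  "epow a r =
    (if r = \<infinity> then (if a < 1 then 0 else if a = 1 then 1 else \<infinity>)
     else if a = \<infinity> then \<infinity>
     else ereal (real_of_ereal a powr real_of_ereal r))"

definition lower_Ahlfors_regular :: "'a::metric_space measure \<Rightarrow> ('a \<Rightarrow> ereal) \<Rightarrow> bool" where
  "lower_Ahlfors_regular M Q \<longleftrightarrow>
     (\<exists>b::real. 0 < b \<and> (\<forall>x r. 0 < r \<and> r \<le> 1 \<longrightarrow>
        ereal b * epow (ereal r) (Q x) \<le> enn2ereal (emeasure M (ball x r))))"


section \<open>Lebesgue and mixed Lebesgue spaces\<close>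

text \<open>
  Functions are extended-real valued and not quotiented by almost everywhere equality.
  Quasi-norms take values in \<^typ>\<open>ennreal\<close>, with infimum \<open>\<infinity>\<close> over the empty set.
\<close>

definition modular :: "'a measure \<Rightarrow> ('a \<Rightarrow> ereal) \<Rightarrow> ('a \<Rightarrow> ereal) \<Rightarrow> ennreal" where
  "modular M p u = (\<integral>\<^sup>+x. e2ennreal (epow \<bar>u x\<bar> (p x)) \<partial>M)"

definition Lp_space :: "'a measure \<Rightarrow> ('a \<Rightarrow> ereal) \<Rightarrow> ('a \<Rightarrow> ereal) set" where
  "Lp_space M p =
     {u \<in> borel_measurable M. \<exists>l::real. 0 < l \<and> modular M p (\<lambda>x. ereal l * u x) < \<infinity>}"

definition Lp_norm :: "'a measure \<Rightarrow> ('a \<Rightarrow> ereal) \<Rightarrow> ('a \<Rightarrow> ereal) \<Rightarrow> ennreal" where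
  "Lp_norm M p u =
     (INF l\<in>{l::real. 0 < l \<and> modular M p (\<lambda>x. u x / ereal l) \<le> 1}. ennreal l)"

definition lq_norm :: "ereal \<Rightarrow> (int \<Rightarrow> ereal) \<Rightarrow> ereal" where
  "lq_norm q a =
     (if q = \<infinity> then (SUP k. \<bar>a k\<bar>)
      else epow (enn2ereal (\<Sum>\<^sub>\<infinity>k. e2ennreal (epow \<bar>a k\<bar> q))) (1 / q))"

definition Lp_lq_norm ::
  "'a measure \<Rightarrow> ('a \<Rightarrow> ereal) \<Rightarrow> ('a \<Rightarrow> ereal) \<Rightarrow> (int \<Rightarrow> 'a \<Rightarrow> ereal) \<Rightarrow> ennreal" where
  "Lp_lq_norm M p q u = Lp_norm M p (\<lambda>x. lq_norm (q x) (\<lambda>k. u k x))"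

definition lq_Lp_modular ::
  "'a measure \<Rightarrow> ('a \<Rightarrow> ereal) \<Rightarrow> ('a \<Rightarrow> ereal) \<Rightarrow> (int \<Rightarrow> 'a \<Rightarrow> ereal) \<Rightarrow> ennreal" where
  "lq_Lp_modular M p q u =
     (\<Sum>\<^sub>\<infinity>k. INF l\<in>{l::real. 0 < l \<and>
        modular M p (\<lambda>x. u k x / epow (ereal l) (1 / q x)) \<le> 1}. ennreal l)"

definition lq_Lp_norm ::
  "'a measure \<Rightarrow> ('a \<Rightarrow> ereal) \<Rightarrow> ('a \<Rightarrow> ereal) \<Rightarrow> (int \<Rightarrow> 'a \<Rightarrow> ereal) \<Rightarrow> ennreal" where
  "lq_Lp_norm M p q u =
     (INF m\<in>{m::real. 0 < m \<and> lq_Lp_modular M p q (\<lambda>k x. u k x / ereal m) \<le> 1}. ennreal m)"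


section \<open>Vector gradients and the spaces \<open>M\<close> and \<open>N\<close>\<close>

text \<open>
  Meaningful for \<open>u\<close> measurable and finite almost everywhere. The value of \<open>\<infinity> - \<infinity>\<close> does not
  matter, as the points where \<open>u\<close> is infinite can be put into the null set.
\<close>

definition vector_gradients ::
  "'a::metric_space measure \<Rightarrow> ('a \<Rightarrow> ereal) \<Rightarrow> ('a \<Rightarrow> ereal) \<Rightarrow> (int \<Rightarrow> 'a \<Rightarrow> ereal) set" where
  "vector_gradients M s u =
     {g. (\<forall>k. g k \<in> borel_measurable M \<and> (\<forall>x. 0 \<le> g k x)) \<and>
         (\<exists>N\<in>null_sets M. \<forall>k. \<forall>x\<in>- N. \<forall>y\<in>- N.
            2 powi (- k - 1) \<le> dist x y \<and> dist x y < 2 powi (- k) \<longrightarrow>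
            \<bar>u x - u y\<bar> \<le> epow (ereal (dist x y)) (s x) * g k x
                           + epow (ereal (dist x y)) (s y) * g k y)}"

definition M_seminorm ::
  "'a::metric_space measure \<Rightarrow> ('a \<Rightarrow> ereal) \<Rightarrow> ('a \<Rightarrow> ereal) \<Rightarrow> ('a \<Rightarrow> ereal)
    \<Rightarrow> ('a \<Rightarrow> ereal) \<Rightarrow> ennreal" where
  "M_seminorm M s p q u = (INF g\<in>vector_gradients M s u. Lp_lq_norm M p q g)"

definition N_seminorm ::
  "'a::metric_space measure \<Rightarrow> ('a \<Rightarrow> ereal) \<Rightarrow> ('a \<Rightarrow> ereal) \<Rightarrow> ('a \<Rightarrow> ereal)
    \<Rightarrow> ('a \<Rightarrow> ereal) \<Rightarrow> ennreal" where
  "N_seminorm M s p q u = (INF g\<in>vector_gradients M s u. lq_Lp_norm M p q g)"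

definition M_space ::
  "'a::metric_space measure \<Rightarrow> ('a \<Rightarrow> ereal) \<Rightarrow> ('a \<Rightarrow> ereal) \<Rightarrow> ('a \<Rightarrow> ereal)
    \<Rightarrow> ('a \<Rightarrow> ereal) set" where
  "M_space M s p q = {u \<in> Lp_space M p. M_seminorm M s p q u < \<infinity>}"

definition N_space ::
  "'a::metric_space measure \<Rightarrow> ('a \<Rightarrow> ereal) \<Rightarrow> ('a \<Rightarrow> ereal) \<Rightarrow> ('a \<Rightarrow> ereal)
    \<Rightarrow> ('a \<Rightarrow> ereal) set" where
  "N_space M s p q = {u \<in> Lp_space M p. N_seminorm M s p q u < \<infinity>}"

definition M_norm ::
  "'a::metric_space measure \<Rightarrow> ('a \<Rightarrow> ereal) \<Rightarrow> ('a \<Rightarrow> ereal) \<Rightarrow> ('a \<Rightarrow> ereal)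
    \<Rightarrow> ('a \<Rightarrow> ereal) \<Rightarrow> ennreal" where
  "M_norm M s p q u = Lp_norm M p u + M_seminorm M s p q u"

definition N_norm ::
  "'a::metric_space measure \<Rightarrow> ('a \<Rightarrow> ereal) \<Rightarrow> ('a \<Rightarrow> ereal) \<Rightarrow> ('a \<Rightarrow> ereal)
    \<Rightarrow> ('a \<Rightarrow> ereal) \<Rightarrow> ennreal" where
  "N_norm M s p q u = Lp_norm M p u + N_seminorm M s p q u"


section \<open>Compact embeddings\<close>

text \<open>
  The spaces \<open>Y\<close> and \<open>Z\<close> are given by their elements and their quasi-norms. The conjuncts are
  inclusion, continuity of the inclusion at every point, and total boundedness of bounded sets.
\<close>

definition compact_embedding ::
  "('a \<Rightarrow> ereal) set \<Rightarrow> (('a \<Rightarrow> ereal) \<Rightarrow> ennreal) \<Rightarrow>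
   ('a \<Rightarrow> ereal) set \<Rightarrow> (('a \<Rightarrow> ereal) \<Rightarrow> ennreal) \<Rightarrow> bool" where
  "compact_embedding Y normY Z normZ \<longleftrightarrow>
     Y \<subseteq> Z \<and>
     (\<forall>u\<in>Y. \<forall>\<epsilon>>0. \<exists>\<delta>>0. \<forall>v\<in>Y.
        normY (\<lambda>x. v x - u x) < \<delta> \<longrightarrow> normZ (\<lambda>x. v x - u x) < \<epsilon>) \<and>
     (\<forall>B\<subseteq>Y. (\<exists>R<\<infinity>. \<forall>u\<in>B. normY u \<le> R) \<longrightarrow>
        (\<forall>\<epsilon>>0. \<exists>K. finite K \<and> K \<subseteq> Z \<and>
           (\<forall>u\<in>B. \<exists>v\<in>K. normZ (\<lambda>x. u x - v x) < \<epsilon>)))"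

end

theory Submission imports Defs
begin

text \<open>
  All three embeddings follow from one statement about functions with a single gradient, that is,
  functions \<open>u\<close> with \<open>|u(x) - u(y)| \<le> d(x,y)\<^bsup>s(x)\<^esup> g(x) + d(x,y)\<^bsup>s(y)\<^esup> g(y)\<close> for \<open>d(x,y) < 1\<close>, where
  the modulars of \<open>u\<close> and \<open>g\<close> in \<open>L\<^bsup>p(\<cdot>)\<^esup>\<close> are bounded by a constant (\<open>hajlasz_ball\<close>). A sequence
  \<open>g\<^sub>k\<close> is turned into one function by a supremum over \<open>k \<ge> 0\<close>. In the space \<open>M\<close> the supremum
  is at most the \<open>\<ell>\<^bsup>q(x)\<^esup>\<close> quasi-norm. In the space \<open>N\<close> with \<open>q \<le> p\<close>, the \<open>k\<close>-th summand of the
  modular of \<open>\<ell>\<^bsup>q(\<cdot>)\<^esup>(L\<^bsup>p(\<cdot>)\<^esup>)\<close> dominates the integral of \<open>g\<^sub>k\<^bsup>p\<^esup>\<close> up to a constant, and the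
  \<open>p\<close>-th power of a supremum is at most the sum of the \<open>p\<close>-th powers. If \<open>t \<lless> s\<close>, the integrals
  of \<open>g\<^sub>k\<^bsup>p\<^esup>\<close> are merely bounded; but lowering the smoothness from \<open>s\<close> to \<open>t\<close> gains a factor
  \<open>2\<^bsup>-\<epsilon>k\<^esup>\<close> at distances below \<open>2\<^bsup>-k\<^esup>\<close>, and the sum becomes a geometric series.

  For a single gradient there is a pointwise form of the Sobolev inequality (\<open>sobolev_pointwise\<close>).
  Fix \<open>x\<close>. As the ball of radius \<open>2\<^bsup>-m\<^esup>\<close> around \<open>x\<close> has measure at least a constant times
  \<open>2\<^bsup>-mQ(x)\<^esup>\<close>, Chebyshev's inequality yields a point \<open>x\<^sub>m\<close> in it with
  \<open>g(x\<^sub>m) \<le> C 2\<^bsup>mQ(x)/p(x)\<^esup>\<close>; the exponents may be evaluated at \<open>x\<close> in place of \<open>x\<^sub>m\<close> because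
  they are log-Hoelder continuous. Along the chain \<open>x\<^sub>1, x\<^sub>2, \<dots>\<close> the function \<open>u\<close> changes in the
  \<open>m\<close>-th step by at most \<open>C 2\<^bsup>m(Q/p - s)\<^esup>\<close>, which sums like a geometric series because
  \<open>sp \<lless> Q\<close>. Joining the chain to \<open>x\<close> gives
  \<open>|u(x)| \<le> C 2\<^bsup>m(Q/p - s)\<^esup> + 2\<^bsup>-ms\<^esup> g(x)\<close>, and the choice \<open>2\<^bsup>mQ/p\<^esup> \<approx> g(x)\<close> turns this into
  \<open>|u|\<^bsup>\<gamma>\<^esup> \<le> C (1 + g\<^bsup>p\<^esup>)\<close>.

  Compactness follows since \<open>\<beta> \<lless> \<gamma>\<close> makes the integral of \<open>|u|\<^bsup>\<beta>\<^esup>\<close> over \<open>{|u| > T\<^sub>0}\<close> uniformly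
  small for large \<open>T\<^sub>0\<close>. Where \<open>|u| \<le> T\<^sub>0\<close> and \<open>g \<le> T\<close>, the function \<open>u\<close> hardly varies on sets
  of small diameter, so it is close to one of finitely many step functions on a finite
  partition of the totally bounded space; and \<open>{g > T}\<close> has small measure
  (\<open>hajlasz_finite_net\<close>). Homogeneity of the quasi-norms converts these statements about modulars
  into the compact embedding (\<open>compact_embedding_if_hajlasz_ball\<close>).
\<close>

section \<open>A pointwise Sobolev inequality along chains of balls\<close>

text \<open>
  If \<open>t\<close> is the difference of the values of a log-Hoelder continuous exponent at two points of
  distance \<open>d < r\<close>, then \<open>|t| ln (1/r) \<le> C\<close>. Up to constants, exponents of \<open>r\<close> may thus be
  evaluated at any point of a ball of radius \<open>r\<close>.
\<close>

lemma powr_log_modulus_le: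
  fixes r t d C :: real
  assumes "0 < d" "d < r" "r \<le> 1" "\<bar>t\<bar> \<le> C / ln (exp 1 + 1 / d)"
  shows "r powr - t \<le> exp C"
proof -
  have r: "0 < r" using assms by simp
  have "ln (1 / r) \<le> ln (exp 1 + 1 / d)"
  proof (rule ln_mono)
    have "1 / r \<le> 1 / d" using assms by (intro divide_left_mono) auto
    then show "1 / r \<le> exp 1 + 1 / d" using exp_ge_zero[of "1::real"] by linarith
  qed (use r in simp)
  then have 1: "- ln r \<le> ln (exp 1 + 1 / d)" using r by (simp add: ln_div)
  have "1 < exp (1::real)" "0 < 1 / d" using assms by auto
  then have 2: "0 < ln (exp 1 + 1 / d)" by (intro ln_gt_zero) linarith
  have "- t * ln r \<le> \<bar>t\<bar> * (- ln r)"
    using assms r by (smt (verit) mult_minus_left mult_minus_right ln_le_zero_iff mult_right_mono_neg)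
  also have "\<dots> \<le> \<bar>t\<bar> * ln (exp 1 + 1 / d)" using 1 by (intro mult_left_mono) auto
  also have "\<dots> \<le> C" using assms(4) 2 by (simp add: field_simps)
  finally show ?thesis using r by (simp add: powr_def)
qed

text \<open>
  The setting of the pointwise estimates: the exponents \<open>p\<close>, \<open>s\<close>, \<open>Q\<close>, \<open>\<beta>\<close> appear as
  real-valued functions \<open>P\<close>, \<open>S\<close>, \<open>Q\<close>, \<open>B\<close>, and the null set \<open>E\<close> contains the points where they are
  infinite or violate their almost everywhere bounds. Two constants \<open>l \<le> 1 \<le> L\<close> stand for all
  lower and all upper bounds; the constants in the pointwise estimates depend only on them and on the
  bound \<open>c\<close> of the modulars.
\<close>

locale sobolev_exponents =
  fixes M :: "'a::metric_space measure"
    and P S Q B :: "'a \<Rightarrow> real" and E :: "'a set" and l L :: real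
  assumes sets_M: "sets M = sets borel"
    and finite_M: "emeasure M UNIV < \<infinity>"
    and null_E: "E \<in> null_sets M"
    and P_measurable: "P \<in> borel_measurable M"
    and l: "0 < l" "l \<le> 1" and L: "1 \<le> L"
    and P_bounds: "\<And>x. x \<notin> E \<Longrightarrow> l \<le> P x \<and> P x \<le> L"
    and S_bounds: "\<And>x. x \<notin> E \<Longrightarrow> l \<le> S x \<and> S x \<le> L"
    and B_bounds: "\<And>x. x \<notin> E \<Longrightarrow> l \<le> B x \<and> B x \<le> L"
    and Q_bound: "\<And>x. x \<notin> E \<Longrightarrow> Q x \<le> L"
    and subcritical: "\<And>x. x \<notin> E \<Longrightarrow> l \<le> Q x - S x * P x"
    and B_less: "\<And>x. x \<notin> E \<Longrightarrow> B x + l \<le> Q x * P x / (Q x - S x * P x)"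
    and P_log: "\<And>x y. x \<notin> E \<Longrightarrow> y \<notin> E \<Longrightarrow> x \<noteq> y \<Longrightarrow>
      \<bar>1 / P x - 1 / P y\<bar> \<le> L / ln (exp 1 + 1 / dist x y)"
    and S_log: "\<And>x y. x \<notin> E \<Longrightarrow> y \<notin> E \<Longrightarrow> x \<noteq> y \<Longrightarrow>
      \<bar>S x - S y\<bar> \<le> L / ln (exp 1 + 1 / dist x y)"
    and ball_lower: "\<And>x r. x \<notin> E \<Longrightarrow> 0 < r \<Longrightarrow> r \<le> 1 \<Longrightarrow>
      ennreal (l * r powr Q x) \<le> emeasure M (ball x r)"
begin

lemma space_M: "space M = UNIV"
  using sets_M by (metis sets_eq_imp_space_eq space_borel)

text \<open>
  Distances below 1 are all that the chains below involve. The null set \<open>N\<close> depends on \<open>U\<close>,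
  in contrast to \<open>E\<close>.
\<close>

definition hajlasz_pair :: "real \<Rightarrow> 'a set \<Rightarrow> ('a \<Rightarrow> real) \<Rightarrow> ('a \<Rightarrow> real) \<Rightarrow> bool" where
  "hajlasz_pair c N U G \<longleftrightarrow>
     N \<in> null_sets M \<and> E \<subseteq> N \<and>
     U \<in> borel_measurable M \<and> G \<in> borel_measurable M \<and> (\<forall>x. 0 \<le> G x) \<and>
     (\<integral>\<^sup>+x. ennreal (\<bar>U x\<bar> powr P x) \<partial>M) + (\<integral>\<^sup>+x. ennreal (G x powr P x) \<partial>M) \<le> ennreal c \<and>
     (\<forall>x\<in>- N. \<forall>y\<in>- N. dist x y < 1 \<longrightarrow>
        \<bar>U x - U y\<bar> \<le> dist x y powr S x * G x + dist x y powr S y * G y)"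

lemma S_powr_comparable:
  assumes "x \<notin> E" "y \<notin> E" "dist x y < r" "r \<le> 1"
  shows "r powr S y \<le> exp L * r powr S x"
proof (cases "x = y")
  case True
  then show ?thesis using L by (simp add: mult_le_cancel_right1)
next
  case False
  have "0 < r" using assms by (meson le_less_trans zero_le_dist)
  have "r powr - (S x - S y) \<le> exp L"
    by (rule powr_log_modulus_le[of "dist x y"]) (use False assms S_log in auto)
  then have "r powr S x * r powr - (S x - S y) \<le> r powr S x * exp L"
    by (intro mult_left_mono) auto
  then show ?thesis by (simp add: powr_add[symmetric] mult.commute)
qed

lemma P_powr_comparable:
  assumes "x \<notin> E" "y \<notin> E" "dist x y < r" "r \<le> 1"
  shows "r powr - (Q x / P y) \<le> exp (L * L) * r powr - (Q x / P x)"
proof (cases "x = y")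
  case True
  then show ?thesis using L by (simp add: mult_le_cancel_right1)
next
  case False
  have r: "0 < r" using assms by (meson le_less_trans zero_le_dist)
  have Q: "0 \<le> Q x" "Q x \<le> L"
    using subcritical[OF assms(1)] Q_bound[OF assms(1)] P_bounds[OF assms(1)] S_bounds[OF assms(1)] l
    by (smt (verit) mult_nonneg_nonneg)+
  have "\<bar>Q x * (1 / P y - 1 / P x)\<bar> = Q x * \<bar>1 / P x - 1 / P y\<bar>"
    using Q by (simp add: abs_mult abs_minus_commute)
  also have "\<dots> \<le> L * (L / ln (exp 1 + 1 / dist x y))"
    by (intro mult_mono) (use Q False assms P_log in auto)
  finally have "r powr - (Q x * (1 / P y - 1 / P x)) \<le> exp (L * L)"
    by (intro powr_log_modulus_le[of "dist x y"]) (use False assms in auto)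
  then have "r powr - (Q x / P x) * r powr - (Q x * (1 / P y - 1 / P x))
      \<le> r powr - (Q x / P x) * exp (L * L)"
    by (intro mult_left_mono) auto
  then show ?thesis by (simp add: powr_add[symmetric] mult.commute algebra_simps)
qed

text \<open>
  By Chebyshev's inequality: otherwise the two integrands together would exceed \<open>2 c / (l r\<^bsup>Q(x)\<^esup>)\<close> almost
  everywhere on the ball, whose measure is at least \<open>l r\<^bsup>Q(x)\<^esup>\<close>, and so have integral at least \<open>2 c\<close>.
\<close>

lemma good_point:
  assumes h: "hajlasz_pair c N U G" and c: "0 < c" and x: "x \<notin> E" and r: "0 < r" "r \<le> 1"
  obtains y where "y \<in> ball x r" "y \<notin> N"
    "\<bar>U y\<bar> powr P y \<le> 2 * c / l * r powr - Q x" "G y powr P y \<le> 2 * c / l * r powr - Q x"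
proof -
  define k where "k = 2 * c / l * r powr - Q x"
  define f where "f y = ennreal (\<bar>U y\<bar> powr P y) + ennreal (G y powr P y)" for y
  have k: "0 < k" using c l r by (simp add: k_def)
  note [measurable] = P_measurable
  have [measurable]: "U \<in> borel_measurable M" "G \<in> borel_measurable M" "ball x r \<in> sets M"
    using h sets_M by (auto simp: hajlasz_pair_def)
  have int_f: "(\<integral>\<^sup>+y. f y \<partial>M) \<le> ennreal c"
    using h unfolding f_def hajlasz_pair_def by (subst nn_integral_add) auto
  have "\<exists>y\<in>ball x r - N. f y \<le> ennreal k"
  proof (rule ccontr)
    assume "\<not> ?thesis"
    then have *: "ennreal k < f y" if "y \<in> ball x r" "y \<notin> N" for y using that by force
    have "ennreal (2 * c) = ennreal k * ennreal (l * r powr Q x)"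
      using l r k c by (subst ennreal_mult[symmetric]) (auto simp: k_def powr_minus field_simps)
    also have "\<dots> \<le> ennreal k * emeasure M (ball x r)"
      using ball_lower[OF x r] by (intro mult_left_mono) auto
    also have "\<dots> = (\<integral>\<^sup>+y. ennreal k * indicator (ball x r) y \<partial>M)"
      by (subst nn_integral_cmult_indicator) auto
    also have "\<dots> \<le> (\<integral>\<^sup>+y. f y \<partial>M)"
    proof (rule nn_integral_mono_AE)
      have "AE y in M. y \<notin> N" using h by (intro AE_not_in) (auto simp: hajlasz_pair_def)
      then show "AE y in M. ennreal k * indicator (ball x r) y \<le> f y"
        by eventually_elim (use * in \<open>auto split: split_indicator intro: less_imp_le\<close>)
    qed
    also note int_f
    finally show False using c by simp
  qed
  then obtain y where y: "y \<in> ball x r" "y \<notin> N" "f y \<le> ennreal k" by auto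
  from y(3) have "\<bar>U y\<bar> powr P y + G y powr P y \<le> k"
    using k by (simp add: f_def ennreal_plus[symmetric] del: ennreal_plus)
  then have "\<bar>U y\<bar> powr P y \<le> k" "G y powr P y \<le> k"
    using powr_ge_zero[of "G y" "P y"] powr_ge_zero[of "\<bar>U y\<bar>" "P y"] by linarith+
  then show thesis using that y unfolding k_def by blast
qed

text \<open>
  Taking the root of order \<open>P y\<close> in the previous bound produces \<open>r\<^bsup>-Q(x)/P(y)\<^esup>\<close>, in which log-Hoelder
  continuity allows \<open>P y\<close> to be replaced by \<open>P x\<close>.
\<close>

lemma good_point_bound:
  assumes h: "hajlasz_pair c N U G" and c: "1 \<le> c" and x: "x \<notin> E" and r: "0 < r" "r \<le> 1"
  obtains y where "dist x y < r" "y \<notin> N"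
    "\<bar>U y\<bar> \<le> (2 * c / l) powr (1 / l) * exp (L * L) * r powr - (Q x / P x)"
    "G y \<le> (2 * c / l) powr (1 / l) * exp (L * L) * r powr - (Q x / P x)"
proof -
  obtain y where y: "y \<in> ball x r" "y \<notin> N"
    "\<bar>U y\<bar> powr P y \<le> 2 * c / l * r powr - Q x" "G y powr P y \<le> 2 * c / l * r powr - Q x"
    using good_point[OF h _ x r] c by auto
  have yE: "y \<notin> E" using y h by (auto simp: hajlasz_pair_def)
  have Py: "l \<le> P y" "0 < P y" using P_bounds[OF yE] l by auto
  have K: "1 \<le> 2 * c / l" using c l by (simp add: field_simps)
  have *: "t \<le> (2 * c / l) powr (1 / l) * exp (L * L) * r powr - (Q x / P x)"
    if t: "0 \<le> t" "t powr P y \<le> 2 * c / l * r powr - Q x" for t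
  proof -
    have "t = (t powr P y) powr (1 / P y)" using t Py by (simp add: powr_powr)
    also have "\<dots> \<le> (2 * c / l * r powr - Q x) powr (1 / P y)"
      using t Py by (intro powr_mono2) auto
    also have "\<dots> = (2 * c / l) powr (1 / P y) * r powr - (Q x / P y)"
      using K powr_mult[of "2 * c / l" "r powr - Q x" "1 / P y"] by (simp add: powr_powr)
    also have "\<dots> \<le> (2 * c / l) powr (1 / l) * (exp (L * L) * r powr - (Q x / P x))"
      using K Py l y r P_powr_comparable[OF x yE, of r]
      by (intro mult_mono powr_mono) (auto simp: field_simps)
    finally show ?thesis by (simp add: mult.assoc)
  qed
  show thesis using that[of y] y * h by (auto simp: hajlasz_pair_def)
qed

lemma Q_pos: "0 < Q x" if "x \<notin> E"
proof -
  have "0 \<le> S x * P x" using P_bounds[OF that] S_bounds[OF that] l by (intro mult_nonneg_nonneg) auto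
  then show ?thesis using subcritical[OF that] l by linarith
qed

text \<open>
  The chain is built by induction, each new point being a good point of the ball of half the radius.
  One step changes \<open>U\<close> by at most \<open>A2 2\<^bsup>ma\<^esup>\<close>. Since \<open>a \<ge> l / L\<close>, the constant
  \<open>A3 = A2 / (2\<^bsup>l/L\<^esup> - 1) + \<dots>\<close> satisfies \<open>A3 + A2 \<le> A3 2\<^bsup>a\<^esup>\<close>, so that the bound
  \<open>A3 2\<^bsup>ma\<^esup>\<close> reproduces itself; this is the summation of the geometric series.
\<close>

lemma chain_point:
  assumes h: "hajlasz_pair c N U G" and c: "1 \<le> c" and x: "x \<notin> N"
  defines "w \<equiv> Q x / P x" and "a \<equiv> Q x / P x - S x"
    and "A1 \<equiv> (2 * c / l) powr (1 / l) * exp (L * L)"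
    and "A2 \<equiv> 2 powr L * exp L * ((2 * c / l) powr (1 / l) * exp (L * L)) * (1 + 2 powr (L / l))"
  shows "\<exists>y. y \<notin> N \<and> dist x y < 2 powr - real (Suc n) \<and> G y \<le> A1 * 2 powr (real (Suc n) * w) \<and>
     \<bar>U y\<bar> \<le> (A2 / (2 powr (l / L) - 1) + A1 * 2 powr (L / l)) * 2 powr (real (Suc n) * a)"
proof (induction n)
  have EN: "E \<subseteq> N" using h by (auto simp: hajlasz_pair_def)
  then have xE: "x \<notin> E" using x by auto
  note b = P_bounds[OF xE] S_bounds[OF xE] Q_bound[OF xE] subcritical[OF xE]
  have SP: "0 \<le> S x * P x" using b l by (intro mult_nonneg_nonneg) auto
  have w: "0 \<le> w" "w \<le> L / l"
    using b l Q_pos[OF xE] by (auto simp: w_def intro!: frac_le divide_nonneg_nonneg)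
  have a_eq: "a = (Q x - S x * P x) / P x" using b l by (auto simp: a_def field_simps)
  have a: "l / L \<le> a"
    unfolding a_eq using b l L by (intro frac_le) auto
  have A1: "0 \<le> A1" by (simp add: A1_def)
  have A2: "0 \<le> A2" by (simp add: A2_def add_nonneg_nonneg)
  have lL: "0 < 2 powr (l / L) - 1" using l L by simp
  let ?A3 = "A2 / (2 powr (l / L) - 1) + A1 * 2 powr (L / l)"
  have A3: "0 \<le> ?A3" using A1 A2 lL by (intro add_nonneg_nonneg divide_nonneg_pos) auto
  have good: "\<exists>y. dist x y < 2 powr - real (Suc n) \<and> y \<notin> N \<and>
      \<bar>U y\<bar> \<le> A1 * 2 powr (real (Suc n) * w) \<and> G y \<le> A1 * 2 powr (real (Suc n) * w)" for n
  proof -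
    define m where "m = real (Suc n)"
    have m: "0 < 2 powr - m" "2 powr - m \<le> 1" using powr_mono[of "- m" 0 2] by (simp_all add: m_def del: of_nat_Suc)
    have p: "(2 powr - m) powr - (Q x / P x) = 2 powr (m * w)" by (simp add: powr_powr w_def)
    show ?thesis
      using good_point_bound[OF h c xE m] unfolding p A1_def m_def[symmetric] by metis
  qed
  {
    case 0
    obtain y where y: "dist x y < 2 powr - real (Suc 0)" "y \<notin> N"
      "\<bar>U y\<bar> \<le> A1 * 2 powr (real (Suc 0) * w)" "G y \<le> A1 * 2 powr (real (Suc 0) * w)"
      using good[of 0] by auto
    have "\<bar>U y\<bar> \<le> (A1 * 2 powr (L / l)) * 1"
      using y(3) w A1 by (auto intro!: mult_left_mono elim!: order_trans)
    also have "\<dots> \<le> ?A3 * 2 powr (real (Suc 0) * a)"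
    proof (intro mult_mono)
      have "0 \<le> l / L" using l L by simp
      then show "1 \<le> 2 powr (real (Suc 0) * a)" using a by (simp add: ge_one_powr_ge_zero)
    qed (use A1 A2 A3 lL in auto)
    finally show ?case using y by auto
  next
    case (Suc n)
    define m where "m = real (Suc n)"
    have m: "1 \<le> m" "real (Suc (Suc n)) = m + 1" by (auto simp: m_def)
    obtain y where y: "y \<notin> N" "dist x y < 2 powr - m" "G y \<le> A1 * 2 powr (m * w)"
      "\<bar>U y\<bar> \<le> ?A3 * 2 powr (m * a)"
      using Suc by (auto simp: m_def)
    obtain z where z: "dist x z < 2 powr - (m + 1)" "z \<notin> N" "G z \<le> A1 * 2 powr ((m + 1) * w)"
      using good[of "Suc n"] unfolding m by auto
    define R :: real where "R = 2 powr (1 - m)"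
    have R: "0 < R" "R \<le> 1" using m(1) powr_mono[of "1 - m" 0 2] by (simp_all add: R_def)
    have r1: "2 powr - m = R / 2" by (simp add: R_def powr_diff powr_minus field_simps)
    have r2: "2 powr - (m + 1) = R / 4"
      by (simp add: R_def powr_diff powr_minus powr_add field_simps)
    have d: "dist y z < R" "dist x y < R" "dist x z < R"
      using y(2) z(1) dist_triangle[of y z x] R unfolding r1 r2 by (auto simp: dist_commute)
    have yz: "y \<notin> E" "z \<notin> E" using y z EN by auto
    have dS: "dist y z powr S v \<le> exp L * R powr S x" if "v = y \<or> v = z" for v
    proof -
      have "v \<notin> E" "dist x v < R" using that yz d by auto
      moreover then have "dist y z powr S v \<le> R powr S v"
        using d S_bounds[of v] l by (intro powr_mono2) auto
      ultimately show ?thesis using S_powr_comparable[OF xE, of v R] R by linarith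
    qed
    have RS: "R powr S x \<le> 2 powr L * 2 powr (- m * S x)"
    proof -
      have "R powr S x = 2 powr S x * 2 powr (- m * S x)"
        by (simp add: R_def powr_powr powr_add[symmetric] algebra_simps)
      then show ?thesis using b by simp
    qed
    have G: "0 \<le> G v" for v using h by (auto simp: hajlasz_pair_def)
    have Gz: "G z \<le> A1 * (2 powr (m * w) * 2 powr (L / l))"
    proof -
      have "2 powr ((m + 1) * w) \<le> 2 powr (m * w) * 2 powr (L / l)"
        using w by (simp add: powr_add[symmetric] algebra_simps)
      then show ?thesis using z(3) A1 by (meson mult_left_mono order_trans)
    qed
    have "\<bar>U y - U z\<bar> \<le> dist y z powr S y * G y + dist y z powr S z * G z"
      using h y z d R unfolding hajlasz_pair_def by force
    also have "\<dots> \<le> exp L * R powr S x * (A1 * 2 powr (m * w))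
        + exp L * R powr S x * (A1 * (2 powr (m * w) * 2 powr (L / l)))"
      using dS y(3) Gz G by (intro add_mono mult_mono) auto
    also have "\<dots> = exp L * A1 * 2 powr (m * w) * (1 + 2 powr (L / l)) * R powr S x"
      by (simp add: algebra_simps)
    also have "\<dots> \<le> exp L * A1 * 2 powr (m * w) * (1 + 2 powr (L / l)) * (2 powr L * 2 powr (- m * S x))"
      using RS A1 by (intro mult_left_mono) (auto intro!: mult_nonneg_nonneg add_nonneg_nonneg)
    also have "\<dots> = A2 * (2 powr (m * w) * 2 powr (- m * S x))"
      by (simp add: A2_def A1_def mult_ac)
    also have "2 powr (m * w) * 2 powr (- m * S x) = 2 powr (m * a)"
      by (simp add: powr_add[symmetric] a_def w_def algebra_simps)
    finally have "\<bar>U z\<bar> \<le> ?A3 * 2 powr (m * a) + A2 * 2 powr (m * a)"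
      using y(4) by linarith
    also have "\<dots> = (?A3 + A2) * 2 powr (m * a)" by (simp add: algebra_simps)
    also have "\<dots> \<le> (?A3 * 2 powr a) * 2 powr (m * a)"
    proof (intro mult_right_mono)
      have "A2 = A2 / (2 powr (l / L) - 1) * (2 powr (l / L) - 1)" using lL l L by simp
      also have "\<dots> \<le> ?A3 * (2 powr a - 1)"
        using A1 A2 A3 lL a by (intro mult_mono) auto
      finally have "A2 \<le> ?A3 * 2 powr a - ?A3 * 1" by (simp only: right_diff_distrib)
      then have "A2 + ?A3 \<le> ?A3 * 2 powr a" by (simp only: le_diff_eq mult_1_right)
      then show "?A3 + A2 \<le> ?A3 * 2 powr a" by (subst add.commute)
    qed auto
    also have "\<dots> = ?A3 * 2 powr ((m + 1) * a)"
      by (simp add: powr_add[symmetric] algebra_simps)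
    finally show ?case using z unfolding m by auto
  }
qed

text \<open>
  The last link, from the \<open>n\<close>-th point of the chain to \<open>x\<close>, is the only one in which \<open>G x\<close> enters.
\<close>

lemma pointwise_bound_at_scale:
  assumes h: "hajlasz_pair c N U G" and c: "1 \<le> c" and x: "x \<notin> N" and n: "1 \<le> (n::nat)"
  defines "A1 \<equiv> (2 * c / l) powr (1 / l) * exp (L * L)"
    and "A2 \<equiv> 2 powr L * exp L * ((2 * c / l) powr (1 / l) * exp (L * L)) * (1 + 2 powr (L / l))"
  shows "\<bar>U x\<bar> \<le> (A2 / (2 powr (l / L) - 1) + A1 * 2 powr (L / l) + exp L * A1)
      * 2 powr (real n * (Q x / P x - S x)) + 2 powr - (real n * S x) * G x"
proof -
  obtain k where k: "n = Suc k" using n by (cases n) auto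
  define m where "m = real n"
  have EN: "E \<subseteq> N" using h by (auto simp: hajlasz_pair_def)
  have A1: "0 \<le> A1" by (simp add: A1_def)
  obtain y where y: "y \<notin> N" "dist x y < 2 powr - m" "G y \<le> A1 * 2 powr (m * (Q x / P x))"
     "\<bar>U y\<bar> \<le> (A2 / (2 powr (l / L) - 1) + A1 * 2 powr (L / l)) * 2 powr (m * (Q x / P x - S x))"
    using chain_point[OF h c x, of k, folded A1_def A2_def] unfolding k m_def by blast
  have r: "2 powr - m \<le> 1" using powr_mono[of "- m" 0 2] by (simp add: m_def)
  have E: "x \<notin> E" "y \<notin> E" using x y EN by auto
  have G: "0 \<le> G v" for v using h by (auto simp: hajlasz_pair_def)
  have 1: "dist x y powr S x \<le> 2 powr - (m * S x)"
  proof -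
    have "dist x y powr S x \<le> (2 powr - m) powr S x"
      using y S_bounds[OF E(1)] l by (intro powr_mono2) auto
    then show ?thesis by (simp add: powr_powr)
  qed
  have 2: "dist x y powr S y \<le> exp L * 2 powr - (m * S x)"
  proof -
    have "dist x y powr S y \<le> (2 powr - m) powr S y"
      using y S_bounds[OF E(2)] l by (intro powr_mono2) auto
    also have "\<dots> \<le> exp L * (2 powr - m) powr S x"
      using S_powr_comparable[OF E y(2) r] .
    finally show ?thesis by (simp add: powr_powr)
  qed
  have "\<bar>U x - U y\<bar> \<le> dist x y powr S x * G x + dist x y powr S y * G y"
    using h y x r unfolding hajlasz_pair_def by force
  also have "\<dots> \<le> 2 powr - (m * S x) * G x +
      exp L * 2 powr - (m * S x) * (A1 * 2 powr (m * (Q x / P x)))"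
    using 1 2 y(3) G by (intro add_mono mult_mono) auto
  also have "exp L * 2 powr - (m * S x) * (A1 * 2 powr (m * (Q x / P x)))
      = exp L * A1 * 2 powr (m * (Q x / P x - S x))"
  proof -
    have "2 powr - (m * S x) * 2 powr (m * (Q x / P x)) = 2 powr (m * (Q x / P x - S x))"
      by (simp add: powr_add[symmetric] algebra_simps)
    then show ?thesis by (metis (no_types, lifting) mult.assoc mult.left_commute)
  qed
  finally show ?thesis using y(4) unfolding m_def by (simp add: algebra_simps)
qed

text \<open>
  The scale \<open>n\<close> is the first one with \<open>G x \<le> 2\<^bsup>(n+1)w\<^esup>\<close>, where \<open>w = Q(x)/P(x)\<close>; it makes both
  terms of the bound at scale \<open>n\<close> comparable to \<open>2\<^bsup>na\<^esup>\<close>. The critical exponent \<open>\<gamma>\<close> is the one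
  with \<open>a \<gamma> = w P\<close>, so \<open>2\<^bsup>na\<gamma>\<^esup>\<close> is the \<open>P\<close>-th power of \<open>2\<^bsup>nw\<^esup>\<close>, and \<open>2\<^bsup>nw\<^esup> < G x\<close>
  by minimality unless \<open>n = 1\<close>.
\<close>

lemma sobolev_pointwise:
  assumes c: "1 \<le> c"
  obtains A where "1 \<le> A" "\<And>U G N x. hajlasz_pair c N U G \<Longrightarrow> x \<notin> N \<Longrightarrow>
     \<bar>U x\<bar> powr (Q x * P x / (Q x - S x * P x)) \<le> A * (1 + G x powr P x)"
proof -
  define A1 where "A1 = (2 * c / l) powr (1 / l) * exp (L * L)"
  define A2 where "A2 = 2 powr L * exp L * ((2 * c / l) powr (1 / l) * exp (L * L)) * (1 + 2 powr (L / l))"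
  define A4 where "A4 = A2 / (2 powr (l / L) - 1) + A1 * 2 powr (L / l) + exp L * A1"
  define A5 where "A5 = A4 + 2 powr (L / l)"
  define A where "A = A5 powr (L * L / l) * 2 powr L"
  have lL: "0 < 2 powr (l / L) - 1" using l L by simp
  have A1: "0 \<le> A1" by (simp add: A1_def)
  have A2: "0 \<le> A2" by (simp add: A2_def add_nonneg_nonneg)
  have A4: "0 \<le> A4" using A1 A2 lL by (auto simp: A4_def intro!: add_nonneg_nonneg divide_nonneg_pos)
  have "0 \<le> L / l" using l L by simp
  then have "1 \<le> 2 powr (L / l)" by (simp add: ge_one_powr_ge_zero)
  then have A5: "1 \<le> A5" using A4 by (simp add: A5_def)
  have "1 * 1 \<le> A" unfolding A_def
    using A5 l L by (intro mult_mono ge_one_powr_ge_zero) auto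
  then have "1 \<le> A" by simp
  moreover have "\<bar>U x\<bar> powr (Q x * P x / (Q x - S x * P x)) \<le> A * (1 + G x powr P x)"
    if h: "hajlasz_pair c N U G" and x: "x \<notin> N" for U G N x
  proof -
    have xE: "x \<notin> E" using h x by (auto simp: hajlasz_pair_def)
    note b = P_bounds[OF xE] S_bounds[OF xE] Q_bound[OF xE] subcritical[OF xE]
    have SP: "0 \<le> S x * P x" using b l by (intro mult_nonneg_nonneg) auto
    define w where "w = Q x / P x"
    define a where "a = Q x / P x - S x"
    define \<gamma> where "\<gamma> = Q x * P x / (Q x - S x * P x)"
    have a_eq: "a = (Q x - S x * P x) / P x" using b l by (auto simp: a_def field_simps)
    have w: "0 < w" "w \<le> L / l"
      using b l Q_pos[OF xE] by (auto simp: w_def intro!: frac_le divide_pos_pos)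
    have \<gamma>: "0 \<le> \<gamma>" "\<gamma> \<le> L * L / l"
      unfolding \<gamma>_def using b l L Q_pos[OF xE]
      by (auto intro!: frac_le mult_mono divide_nonneg_pos mult_nonneg_nonneg)
    have a\<gamma>: "a * \<gamma> = Q x" "w * P x = Q x"
      using b l by (auto simp: a_eq \<gamma>_def w_def)
    have Gx: "0 \<le> G x" using h by (auto simp: hajlasz_pair_def)
    have "\<exists>n::nat. 1 \<le> n \<and> G x \<le> 2 powr ((real n + 1) * w)"
    proof -
      obtain n :: nat where n: "(log 2 (G x + 1)) / w < real n" using reals_Archimedean2 by blast
      have "G x \<le> 2 powr (log 2 (G x + 1))" using Gx by simp
      also have "\<dots> \<le> 2 powr ((real (Suc n) + 1) * w)"
        using n w by (intro powr_mono) (auto simp: field_simps)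
      finally show ?thesis by (intro exI[of _ "Suc n"]) auto
    qed
    then obtain n :: nat where n: "1 \<le> n" "G x \<le> 2 powr ((real n + 1) * w)"
      and least: "\<And>k. k < n \<Longrightarrow> \<not> (1 \<le> k \<and> G x \<le> 2 powr ((real k + 1) * w))"
      using exists_least_iff[of "\<lambda>n. 1 \<le> n \<and> G x \<le> 2 powr ((real n + 1) * w)"] by auto
    define m where "m = real n"
    have "\<bar>U x\<bar> \<le> A4 * 2 powr (m * a) + 2 powr - (m * S x) * G x"
      using pointwise_bound_at_scale[OF h c x n(1)]
      unfolding A4_def A1_def A2_def m_def a_def .
    also have "2 powr - (m * S x) * G x \<le> 2 powr - (m * S x) * 2 powr ((m + 1) * w)"
      using n by (intro mult_left_mono) (auto simp: m_def)
    also have "\<dots> = 2 powr w * 2 powr (m * a)"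
      by (simp add: powr_add[symmetric] a_def w_def algebra_simps add_divide_distrib)
    also have "\<dots> \<le> 2 powr (L / l) * 2 powr (m * a)" using w by simp
    finally have U: "\<bar>U x\<bar> \<le> A5 * 2 powr (m * a)" by (simp add: A5_def algebra_simps)
    have "\<bar>U x\<bar> powr \<gamma> \<le> (A5 * 2 powr (m * a)) powr \<gamma>"
      using U \<gamma> by (intro powr_mono2) auto
    also have "\<dots> = A5 powr \<gamma> * 2 powr (m * Q x)"
      using A5 by (simp add: powr_mult powr_powr a\<gamma> mult.assoc)
    also have "\<dots> \<le> A5 powr (L * L / l) * (2 powr L * (1 + G x powr P x))"
    proof (intro mult_mono)
      show "A5 powr \<gamma> \<le> A5 powr (L * L / l)" using A5 \<gamma> by (intro powr_mono) auto
      have G0: "0 \<le> G x powr P x" by simp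
      have L1: "1 \<le> 2 powr L" using L by (simp add: ge_one_powr_ge_zero)
      show "2 powr (m * Q x) \<le> 2 powr L * (1 + G x powr P x)"
      proof (cases "n = 1")
        case True
        then have "2 powr (m * Q x) \<le> 2 powr L * 1" using b by (simp add: m_def)
        also have "\<dots> \<le> 2 powr L * (1 + G x powr P x)" by (intro mult_left_mono) auto
        finally show ?thesis .
      next
        case False
        then have "\<not> G x \<le> 2 powr ((real (n - 1) + 1) * w)" using least[of "n - 1"] n by auto
        then have "2 powr (m * w) \<le> G x" using n by (simp add: m_def of_nat_diff)
        then have "(2 powr (m * w)) powr P x \<le> G x powr P x" using b l by (intro powr_mono2) auto
        then have "2 powr (m * Q x) \<le> 1 * G x powr P x" by (simp add: powr_powr a\<gamma> mult.assoc)
        also have "\<dots> \<le> 2 powr L * (1 + G x powr P x)" using L1 by (intro mult_mono) auto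
        finally show ?thesis .
      qed
    qed auto
    finally show ?thesis by (simp add: A_def \<gamma>_def mult.assoc)
  qed
  ultimately show thesis using that by blast
qed

end

section \<open>Finite nets of step functions\<close>

lemma exists_large_powr_le:
  fixes k e \<eta> :: real
  assumes "0 < e" "0 < \<eta>"
  obtains T where "1 \<le> T" "k * T powr - e \<le> \<eta>"
proof -
  define z where "z = \<bar>k\<bar> / \<eta> + 1"
  have z: "1 \<le> z" using assms by (simp add: z_def)
  have "k * (z powr (1 / e)) powr - e = k / z"
    using assms z by (simp add: powr_powr powr_minus_divide)
  also have "\<dots> \<le> \<eta>"
  proof -
    have "k \<le> \<bar>k\<bar> + \<eta>" using assms by simp
    also have "\<dots> = \<eta> * z" using assms by (simp add: z_def field_simps)
    finally show ?thesis using z by (simp add: divide_le_eq)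
  qed
  finally show thesis using z assms by (intro that[of "z powr (1 / e)"] ge_one_powr_ge_zero) auto
qed

lemma exists_small_powr_le:
  fixes k e \<eta> :: real
  assumes "0 < e" "0 < \<eta>"
  obtains \<theta> where "0 < \<theta>" "\<theta> \<le> 1" "k * \<theta> powr e \<le> \<eta>"
proof -
  obtain T where T: "1 \<le> T" "k * T powr - e \<le> \<eta>" using exists_large_powr_le[OF assms] .
  have "(1 / T) powr e = T powr - e" using T by (simp add: powr_divide powr_minus_divide)
  then show thesis using T by (intro that[of "1 / T"]) auto
qed

context sobolev_exponents begin

lemma nn_integral_affine_le:
  assumes h: "hajlasz_pair c N U G" and "0 \<le> i" "0 \<le> j" "0 \<le> c"
    and f: "\<And>x. x \<notin> N \<Longrightarrow> f x \<le> i + j * G x powr P x"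
  shows "(\<integral>\<^sup>+x. ennreal (f x) \<partial>M) \<le> ennreal (i * measure M UNIV + j * c)"
proof -
  interpret finite_measure M
    using finite_M space_M by (intro finite_measureI) auto
  note [measurable] = P_measurable
  have [measurable]: "G \<in> borel_measurable M" using h by (auto simp: hajlasz_pair_def)
  have Gc: "(\<integral>\<^sup>+x. ennreal (G x powr P x) \<partial>M) \<le> ennreal c"
  proof -
    have "(\<integral>\<^sup>+x. ennreal (G x powr P x) \<partial>M)
        \<le> (\<integral>\<^sup>+x. ennreal (\<bar>U x\<bar> powr P x) \<partial>M) + (\<integral>\<^sup>+x. ennreal (G x powr P x) \<partial>M)"
      by (intro add_increasing) auto
    also have "\<dots> \<le> ennreal c" using h by (simp add: hajlasz_pair_def)
    finally show ?thesis .
  qed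
  have N: "AE x in M. x \<notin> N" using h by (intro AE_not_in) (auto simp: hajlasz_pair_def)
  have "(\<integral>\<^sup>+x. ennreal (f x) \<partial>M) \<le> (\<integral>\<^sup>+x. ennreal i + ennreal j * ennreal (G x powr P x) \<partial>M)"
    by (rule nn_integral_mono_AE, use N in eventually_elim)
      (use f assms in \<open>auto simp: ennreal_mult[symmetric] ennreal_plus[symmetric] simp del: ennreal_plus intro!: ennreal_leI\<close>)
  also have "\<dots> = ennreal i * emeasure M UNIV + ennreal j * (\<integral>\<^sup>+x. ennreal (G x powr P x) \<partial>M)"
    by (simp add: nn_integral_add nn_integral_cmult space_M)
  also have "\<dots> \<le> ennreal i * ennreal (measure M UNIV) + ennreal j * ennreal c"
    using Gc by (intro add_mono mult_left_mono) (auto simp: emeasure_eq_measure)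
  also have "\<dots> = ennreal (i * measure M UNIV + j * c)"
    using assms by (simp add: ennreal_mult)
  finally show ?thesis .
qed

lemma hajlasz_bounded:
  assumes c: "1 \<le> c"
  obtains D where "1 \<le> D"
    "\<And>U G N. hajlasz_pair c N U G \<Longrightarrow> (\<integral>\<^sup>+x. ennreal (\<bar>U x\<bar> powr B x) \<partial>M) \<le> ennreal D"
proof -
  obtain A where A: "1 \<le> A" "\<And>U G N x. hajlasz_pair c N U G \<Longrightarrow> x \<notin> N \<Longrightarrow>
     \<bar>U x\<bar> powr (Q x * P x / (Q x - S x * P x)) \<le> A * (1 + G x powr P x)"
    by (rule sobolev_pointwise[OF c]) blast
  have "(\<integral>\<^sup>+x. ennreal (\<bar>U x\<bar> powr B x) \<partial>M) \<le> ennreal (max 1 ((1 + A) * measure M UNIV + A * c))"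
    if h: "hajlasz_pair c N U G" for U G N
  proof -
    have "\<bar>U x\<bar> powr B x \<le> (1 + A) + A * G x powr P x" if x: "x \<notin> N" for x
    proof -
      have xE: "x \<notin> E" using h x by (auto simp: hajlasz_pair_def)
      have "\<bar>U x\<bar> powr B x \<le> 1 + \<bar>U x\<bar> powr (Q x * P x / (Q x - S x * P x))"
      proof (cases "\<bar>U x\<bar> \<le> 1")
        case True
        then have "\<bar>U x\<bar> powr B x \<le> 1" using B_bounds[OF xE] l by (intro powr_le1) auto
        then show ?thesis by (simp add: add_increasing2)
      next
        case False
        then have "\<bar>U x\<bar> powr B x \<le> \<bar>U x\<bar> powr (Q x * P x / (Q x - S x * P x))"
          using B_less[OF xE] l by (intro powr_mono) auto
        then show ?thesis by simp
      qed
      also have "\<dots> \<le> 1 + A * (1 + G x powr P x)" using A(2)[OF h x] by simp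
      finally show ?thesis by (simp add: algebra_simps)
    qed
    then have "(\<integral>\<^sup>+x. ennreal (\<bar>U x\<bar> powr B x) \<partial>M) \<le> ennreal ((1 + A) * measure M UNIV + A * c)"
      using A c by (intro nn_integral_affine_le[OF h]) auto
    also have "\<dots> \<le> ennreal (max 1 ((1 + A) * measure M UNIV + A * c))"
      by (intro ennreal_leI) simp
    finally show ?thesis .
  qed
  then show thesis using that[of "max 1 ((1 + A) * measure M UNIV + A * c)"] by simp
qed

text \<open>
  The value \<open>v\<close> is meant to approximate \<open>U x\<close> where both \<open>U\<close> and \<open>G\<close> are moderate. Where only \<open>U\<close> is
  moderate, the difference is at most \<open>3 T0\<close> and \<open>T\<^bsup>-l\<^esup> G\<^bsup>P\<^esup> \<ge> 1\<close>; where \<open>U\<close> is large, the gap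
  between \<open>B\<close> and the critical exponent provides the factor \<open>T0\<^bsup>-l\<^esup>\<close>.
\<close>

lemma difference_powr_le:
  assumes h: "hajlasz_pair c N U G" and x: "x \<notin> N"
    and A: "\<bar>U x\<bar> powr (Q x * P x / (Q x - S x * P x)) \<le> A * (1 + G x powr P x)" "0 \<le> A"
    and T: "1 \<le> T0" "1 \<le> T" and \<theta>: "0 < \<theta>" "\<theta> \<le> 1" and v: "\<bar>v\<bar> \<le> T0"
    and close: "\<bar>U x\<bar> \<le> T0 \<Longrightarrow> G x \<le> T \<Longrightarrow> \<bar>U x - v\<bar> \<le> \<theta>"
  shows "\<bar>U x - v\<bar> powr B x \<le> (\<theta> powr l + 3 powr L * A * T0 powr - l)
     + ((3 * T0) powr L * T powr - l + 3 powr L * A * T0 powr - l) * G x powr P x"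
proof -
  have xE: "x \<notin> E" using h x by (auto simp: hajlasz_pair_def)
  note b = P_bounds[OF xE] B_bounds[OF xE]
  have G: "0 \<le> G x powr P x" by simp
  define i where "i = \<theta> powr l"
  define j where "j = (3 * T0) powr L * T powr - l"
  define k where "k = 3 powr L * A * T0 powr - l"
  have ijk: "0 \<le> i" "0 \<le> j" "0 \<le> k" using A by (auto simp: i_def j_def k_def)
  have "\<bar>U x - v\<bar> powr B x \<le> i \<or> \<bar>U x - v\<bar> powr B x \<le> j * G x powr P x \<or>
      \<bar>U x - v\<bar> powr B x \<le> k * (1 + G x powr P x)"
  proof -
    consider "\<bar>U x\<bar> \<le> T0" "G x \<le> T" | "\<bar>U x\<bar> \<le> T0" "T < G x" | "T0 < \<bar>U x\<bar>" by linarith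
    then show ?thesis
    proof cases
      case 1
      then have "\<bar>U x - v\<bar> powr B x \<le> \<theta> powr B x"
        using close b l by (intro powr_mono2) auto
      also have "\<dots> \<le> \<theta> powr l" using b \<theta> by (intro powr_mono') auto
      finally show ?thesis by (simp add: i_def)
    next
      case 2
      have "\<bar>U x - v\<bar> powr B x \<le> (3 * T0) powr B x"
        using 2 v b l T by (intro powr_mono2) auto
      also have "\<dots> \<le> (3 * T0) powr L * 1" using b T by (simp add: powr_mono)
      also have "\<dots> \<le> (3 * T0) powr L * (T powr - l * G x powr P x)"
      proof (intro mult_left_mono)
        have "T powr l \<le> T powr P x" using b T by (intro powr_mono) auto
        also have "\<dots> \<le> G x powr P x" using 2 T b l by (intro powr_mono2) auto
        finally show "1 \<le> T powr - l * G x powr P x"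
          using T by (simp add: powr_minus field_simps)
      qed auto
      finally show ?thesis by (simp add: j_def mult.assoc)
    next
      case 3
      have "\<bar>U x - v\<bar> powr B x \<le> (3 * \<bar>U x\<bar>) powr B x"
        using 3 v b l T by (intro powr_mono2) auto
      also have "\<dots> = 3 powr B x * \<bar>U x\<bar> powr B x" by (simp add: powr_mult)
      also have "\<dots> \<le> 3 powr L * ((A * (1 + G x powr P x)) * T0 powr - l)"
      proof (intro mult_mono)
        have "\<bar>U x\<bar> powr B x \<le> \<bar>U x\<bar> powr (Q x * P x / (Q x - S x * P x) - l)"
          using B_less[OF xE] 3 T by (intro powr_mono) auto
        also have "\<dots> = \<bar>U x\<bar> powr (Q x * P x / (Q x - S x * P x)) * \<bar>U x\<bar> powr - l"
          by (simp add: powr_add[symmetric])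
        also have "\<dots> \<le> (A * (1 + G x powr P x)) * T0 powr - l"
        proof (intro mult_mono)
          show "\<bar>U x\<bar> powr - l \<le> T0 powr - l"
            using 3 T l by (intro powr_mono2') auto
        qed (use A G in auto)
        finally show "\<bar>U x\<bar> powr B x \<le> (A * (1 + G x powr P x)) * T0 powr - l" .
      qed (use b in auto)
      finally show ?thesis by (simp add: k_def mult_ac)
    qed
  qed
  then have "\<bar>U x - v\<bar> powr B x \<le> i + j * G x powr P x + k * (1 + G x powr P x)"
    using ijk G by (smt (verit, best) mult_nonneg_nonneg)
  then show ?thesis unfolding i_def j_def k_def by (simp add: algebra_simps)
qed

text \<open>
  The index of the first ball containing a point, in a finite cover by balls of radius \<open>\<rho> / 2\<close>,
  depends measurably on the point.
\<close>

lemma measurable_cells: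
  assumes "totally_bounded (UNIV :: 'a set)" and "0 < \<rho>"
  obtains idx :: "'a \<Rightarrow> nat" and n where "idx \<in> measurable M (count_space UNIV)"
    "\<And>x. idx x < n" "\<And>x y. idx x = idx y \<Longrightarrow> dist x y < \<rho>"
proof -
  obtain k where k: "finite k" "(UNIV :: 'a set) \<subseteq> (\<Union>x\<in>k. ball x (\<rho> / 2))"
    using assms(1)[unfolded totally_bounded_metric, rule_format, of "\<rho> / 2"] assms(2)
    unfolding ball_def[symmetric] by auto
  obtain xs where xs: "set xs = k" using finite_list[OF k(1)] by blast
  define idx where "idx y = (LEAST i. i < length xs \<and> y \<in> ball (xs ! i) (\<rho> / 2))" for y
  have idx: "idx y < length xs \<and> y \<in> ball (xs ! idx y) (\<rho> / 2)" for y
  proof -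
    obtain z where "z \<in> set xs" "y \<in> ball z (\<rho> / 2)" using k(2) unfolding xs by blast
    then have "\<exists>i. i < length xs \<and> y \<in> ball (xs ! i) (\<rho> / 2)"
      by (auto simp: in_set_conv_nth)
    then show ?thesis unfolding idx_def by (rule LeastI_ex)
  qed
  have "ball z r \<in> sets M" for z r using sets_M by simp
  then have "{y \<in> space M. i < length xs \<and> y \<in> ball (xs ! i) (\<rho> / 2)} \<in> sets M" for i
    by (cases "i < length xs") (simp_all add: space_M del: mem_ball)
  then have "idx \<in> measurable M (count_space UNIV)"
    unfolding idx_def by - (rule measurable_Least, simp only: pred_def)
  moreover have "dist x y < \<rho>" if "idx x = idx y" for x y
    using idx[of x] idx[of y] that dist_triangle2[of x y "xs ! idx x"]
    by (auto simp: dist_commute)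
  ultimately show thesis using that idx by blast
qed

text \<open>
  The order in which the constants are chosen matters: \<open>T0\<close> controls the part where \<open>U\<close> is
  large, then \<open>T\<close>, depending on \<open>T0\<close>, the part where \<open>G\<close> is large, and finally the mesh \<open>\<rho>\<close>,
  depending on \<open>T\<close>, the oscillation on the remaining set. None of them depends on \<open>U\<close>, and neither
  do the cells and the finite set \<open>V\<close> of values.
\<close>

lemma hajlasz_finite_net:
  assumes c: "1 \<le> c" and tb: "totally_bounded (UNIV :: 'a set)" and \<eta>: "0 < \<eta>"
  obtains K T0 where "finite K" "1 \<le> T0"
    "\<And>v. v \<in> K \<Longrightarrow> v \<in> borel_measurable M" "\<And>v x. v \<in> K \<Longrightarrow> \<bar>v x\<bar> \<le> (T0 :: real)"
    "\<And>U G N. hajlasz_pair c N U G \<Longrightarrow>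
      \<exists>v\<in>K. (\<integral>\<^sup>+x. ennreal (\<bar>U x - v x\<bar> powr B x) \<partial>M) \<le> ennreal \<eta>"
proof -
  define \<mu> where "\<mu> = measure M UNIV"
  obtain A where A: "1 \<le> A" "\<And>U G N x. hajlasz_pair c N U G \<Longrightarrow> x \<notin> N \<Longrightarrow>
     \<bar>U x\<bar> powr (Q x * P x / (Q x - S x * P x)) \<le> A * (1 + G x powr P x)"
    by (rule sobolev_pointwise[OF c]) blast
  have \<eta>3: "0 < \<eta> / 3" using \<eta> by simp
  obtain T0 where T0: "1 \<le> T0" "(3 powr L * A * (\<mu> + c)) * T0 powr - l \<le> \<eta> / 3"
    using exists_large_powr_le[OF l(1) \<eta>3] .
  obtain T where T: "1 \<le> T" "((3 * T0) powr L * c) * T powr - l \<le> \<eta> / 3"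
    using exists_large_powr_le[OF l(1) \<eta>3] .
  obtain \<theta> where \<theta>: "0 < \<theta>" "\<theta> \<le> 1" "\<mu> * \<theta> powr l \<le> \<eta> / 3"
    using exists_small_powr_le[OF l(1) \<eta>3] .
  obtain \<rho> where \<rho>: "0 < \<rho>" "\<rho> \<le> 1" "(2 * T) * \<rho> powr l \<le> \<theta> / 2"
    using exists_small_powr_le[OF l(1) half_gt_zero[OF \<theta>(1)]] .
  obtain V where V: "finite V" "V \<subseteq> {-T0..T0}" "\<And>t. \<bar>t\<bar> \<le> T0 \<Longrightarrow> \<exists>v\<in>V. \<bar>t - v\<bar> < \<theta> / 2"
  proof -
    have "{-T0..T0} \<subseteq> (\<Union>t\<in>{-T0..T0}. ball t (\<theta> / 2))" using \<theta> by auto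
    then obtain D where D: "D \<subseteq> {-T0..T0}" "finite D" "{-T0..T0} \<subseteq> (\<Union>t\<in>D. ball t (\<theta> / 2))"
      using compactE_image[of "{-T0..T0}" "{-T0..T0}" "\<lambda>t. ball t (\<theta> / 2)"] by auto
    have "\<exists>v\<in>D. \<bar>t - v\<bar> < \<theta> / 2" if "\<bar>t\<bar> \<le> T0" for t
    proof -
      have "t \<in> {-T0..T0}" using that by auto
      then obtain v where "v \<in> D" "t \<in> ball v (\<theta> / 2)" using D(3) by blast
      then show ?thesis by (auto simp: dist_real_def abs_minus_commute)
    qed
    then show ?thesis using D that by blast
  qed
  obtain idx :: "'a \<Rightarrow> nat" and n where idx: "idx \<in> measurable M (count_space UNIV)"
    "\<And>x. idx x < n" "\<And>x y. idx x = idx y \<Longrightarrow> dist x y < \<rho>"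
    using measurable_cells[OF tb \<rho>(1)] by blast
  define K where "K = (\<lambda>h y. h (idx y)) ` ({..<n} \<rightarrow>\<^sub>E insert 0 V)"
  have "finite K" unfolding K_def using V by (intro finite_imageI finite_PiE) auto
  moreover have "v \<in> borel_measurable M" if "v \<in> K" for v
    using that idx(1) unfolding K_def by (auto intro: measurable_compose)
  moreover have "\<bar>v x\<bar> \<le> T0" if "v \<in> K" for v x
  proof -
    obtain h where "v = (\<lambda>y. h (idx y))" "h \<in> {..<n} \<rightarrow>\<^sub>E insert 0 V"
      using \<open>v \<in> K\<close> by (auto simp: K_def)
    then have "v x \<in> insert 0 V" using idx(2)[of x] by auto
    moreover have "insert 0 V \<subseteq> {-T0..T0}" using V(2) T0 by auto
    ultimately have "v x \<in> {-T0..T0}" by blast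
    then show ?thesis by auto
  qed
  moreover have "\<exists>v\<in>K. (\<integral>\<^sup>+x. ennreal (\<bar>U x - v x\<bar> powr B x) \<partial>M) \<le> ennreal \<eta>"
    if h: "hajlasz_pair c N U G" for U G N
  proof -
    define good where "good i = {y. idx y = i \<and> y \<notin> N \<and> G y \<le> T \<and> \<bar>U y\<bar> \<le> T0}" for i
    \<comment> \<open>the value on a cell comes from some moderate point of the cell, if there is one\<close>
    have "\<exists>v. v \<in> insert 0 V \<and> (good i \<noteq> {} \<longrightarrow> (\<exists>y\<in>good i. \<bar>U y - v\<bar> < \<theta> / 2))" for i
    proof (cases "good i = {}")
      case False
      then obtain y where "y \<in> good i" by auto
      then show ?thesis using V(3)[of "U y"] by (auto simp: good_def)
    qed auto
    then obtain f where f: "\<And>i. f i \<in> insert 0 V"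
      "\<And>i. good i \<noteq> {} \<Longrightarrow> \<exists>y\<in>good i. \<bar>U y - f i\<bar> < \<theta> / 2" by metis
    define v where "v y = f (idx y)" for y
    have "v = (\<lambda>y. restrict f {..<n} (idx y))" using idx(2) by (auto simp: v_def)
    moreover have "restrict f {..<n} \<in> {..<n} \<rightarrow>\<^sub>E insert 0 V" using f(1) by auto
    ultimately have "v \<in> K" unfolding K_def by blast
    have v: "\<bar>v x\<bar> \<le> T0" for x
    proof -
      have "insert 0 V \<subseteq> {-T0..T0}" using V(2) T0 by auto
      then have "v x \<in> {-T0..T0}" using f(1)[of "idx x"] unfolding v_def by blast
      then show ?thesis by auto
    qed
    have close: "\<bar>U x - v x\<bar> \<le> \<theta>" if x: "x \<notin> N" "\<bar>U x\<bar> \<le> T0" "G x \<le> T" for x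
    proof -
      have "x \<in> good (idx x)" using x by (auto simp: good_def)
      then obtain y where y: "y \<in> good (idx x)" "\<bar>U y - v x\<bar> < \<theta> / 2"
        using f(2)[of "idx x"] by (auto simp: v_def)
      then have d: "dist x y < \<rho>" and y': "y \<notin> N" "G y \<le> T" using idx(3)[of x y] by (auto simp: good_def)
      have G: "0 \<le> G z" for z using h by (auto simp: hajlasz_pair_def)
      have dS: "dist x y powr S z \<le> \<rho> powr l" if "z \<notin> N" for z
      proof -
        have "z \<notin> E" using that h by (auto simp: hajlasz_pair_def)
        then have "l \<le> S z" using S_bounds by auto
        then have "dist x y powr S z \<le> \<rho> powr S z" using d l by (intro powr_mono2) auto
        also have "\<dots> \<le> \<rho> powr l" using \<rho> \<open>l \<le> S z\<close> by (intro powr_mono') auto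
        finally show ?thesis .
      qed
      have "\<bar>U x - U y\<bar> \<le> dist x y powr S x * G x + dist x y powr S y * G y"
        using h x y' d \<rho> unfolding hajlasz_pair_def by force
      also have "\<dots> \<le> \<rho> powr l * T + \<rho> powr l * T"
        using dS x y' G by (intro add_mono mult_mono) auto
      also have "\<dots> \<le> \<theta> / 2" using \<rho>(3) by (simp add: mult_ac)
      finally show ?thesis using y(2) by linarith
    qed
    define i where "i = \<theta> powr l + 3 powr L * A * T0 powr - l"
    define j where "j = (3 * T0) powr L * T powr - l + 3 powr L * A * T0 powr - l"
    have "(\<integral>\<^sup>+x. ennreal (\<bar>U x - v x\<bar> powr B x) \<partial>M) \<le> ennreal (i * \<mu> + j * c)"
      unfolding \<mu>_def
    proof (rule nn_integral_affine_le[OF h])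
      show "\<bar>U x - v x\<bar> powr B x \<le> i + j * G x powr P x" if x: "x \<notin> N" for x
        unfolding i_def j_def
        by (rule difference_powr_le[OF h x A(2)[OF h x]]) (use A T0 T \<theta> v close x in auto)
    qed (use A c in \<open>auto simp: i_def j_def intro!: add_nonneg_nonneg mult_nonneg_nonneg\<close>)
    also have "i * \<mu> + j * c = \<mu> * \<theta> powr l + ((3 * T0) powr L * c) * T powr - l
        + (3 powr L * A * (\<mu> + c)) * T0 powr - l"
      by (simp add: i_def j_def algebra_simps)
    also have "ennreal \<dots> \<le> ennreal \<eta>" using T0 T \<theta> by (intro ennreal_leI) linarith
    finally show ?thesis using \<open>v \<in> K\<close> by blast
  qed
  ultimately show thesis using that[of K T0] T0 by blast
qed

end

section \<open>Modulars and quasi-norms\<close>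

lemma epow_ereal [simp]: "epow (ereal a) (ereal r) = ereal (a powr r)"
  by (simp add: epow_def)

lemma epow_infinity [simp]: "epow \<infinity> (ereal r) = \<infinity>"
  by (simp add: epow_def)

lemma epow_measurable [measurable (raw)]:
  assumes [measurable]: "f \<in> borel_measurable M" "r \<in> borel_measurable M"
  shows "(\<lambda>x. epow (f x) (r x)) \<in> borel_measurable M"
  unfolding epow_def by measurable

lemma epow_nonneg: "0 \<le> a \<Longrightarrow> 0 \<le> epow a r"
  by (auto simp: epow_def)

lemma epow_mono:
  assumes "0 \<le> a" "a \<le> b" "0 < r"
  shows "epow a r \<le> epow b r"
proof (cases "r = \<infinity> \<or> b = \<infinity>")
  case True
  then show ?thesis using assms by (auto simp: epow_def)
next
  case False
  then obtain a' b' r' where "a = ereal a'" "b = ereal b'" "r = ereal r'"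
    using assms by (cases a; cases b; cases r) auto
  then show ?thesis using assms by (auto intro: powr_mono2)
qed

text \<open>
  Comparison with a root, in a form that also covers the value \<open>\<infinity>\<close>; it is what allows suprema
  to be pulled out of powers.
\<close>

lemma epow_le_iff:
  assumes "0 \<le> a" "0 \<le> b" "0 < r"
  shows "epow a (ereal r) \<le> b \<longleftrightarrow> a \<le> epow b (1 / ereal r)"
proof -
  have *: "x powr r \<le> y \<longleftrightarrow> x \<le> y powr (1 / r)" if "0 \<le> x" "0 \<le> y" for x y
  proof -
    have "x powr r \<le> y \<longleftrightarrow> x powr r \<le> (y powr (1 / r)) powr r"
      using that assms by (simp add: powr_powr)
    also have "\<dots> \<longleftrightarrow> x \<le> y powr (1 / r)"
      using that assms by (meson not_le powr_ge_zero powr_less_mono2 powr_mono2 less_imp_le)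
    finally show ?thesis .
  qed
  have "1 / ereal r = ereal (1 / r)" using assms by (simp add: one_ereal_def)
  then show ?thesis using assms * by (cases a; cases b) auto
qed

lemma e2ennreal_le_iff: "0 \<le> a \<Longrightarrow> e2ennreal a \<le> b \<longleftrightarrow> a \<le> enn2ereal b"
  by (metis e2ennreal_enn2ereal e2ennreal_mono enn2ereal_e2ennreal less_eq_ennreal.rep_eq)

lemma modular_mono:
  assumes "AE x in M. 0 < p x" "AE x in M. \<bar>u x\<bar> \<le> \<bar>v x\<bar>"
  shows "modular M p u \<le> modular M p v"
  unfolding modular_def
  by (rule nn_integral_mono_AE, use assms in eventually_elim)
    (auto intro!: e2ennreal_mono epow_mono)

lemma modular_cong_real:
  assumes "AE x in M. p x = ereal (P x) \<and> u x = ereal (U x)"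
  shows "modular M p u = (\<integral>\<^sup>+x. ennreal (\<bar>U x\<bar> powr P x) \<partial>M)"
  unfolding modular_def
  by (rule nn_integral_cong_AE, use assms in eventually_elim) auto

lemma AE_finite_if_modular_finite:
  assumes [measurable]: "u \<in> borel_measurable M" "p \<in> borel_measurable M"
    and p: "AE x in M. \<bar>p x\<bar> \<noteq> \<infinity>" and fin: "modular M p u < \<infinity>"
  shows "AE x in M. \<bar>u x\<bar> \<noteq> \<infinity>"
proof -
  have "AE x in M. e2ennreal (epow \<bar>u x\<bar> (p x)) \<noteq> \<infinity>"
    using fin unfolding modular_def by (intro nn_integral_noteq_infinite) auto
  with p show ?thesis
    by eventually_elim (auto simp: epow_def)
qed

lemma modular_le_cmult:
  assumes [measurable]: "u \<in> borel_measurable M" "p \<in> borel_measurable M"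
    and *: "AE x in M. e2ennreal (epow \<bar>v x\<bar> (p x)) \<le> ennreal k * e2ennreal (epow \<bar>u x\<bar> (p x))"
  shows "modular M p v \<le> ennreal k * modular M p u"
proof -
  have "modular M p v \<le> (\<integral>\<^sup>+x. ennreal k * e2ennreal (epow \<bar>u x\<bar> (p x)) \<partial>M)"
    unfolding modular_def by (rule nn_integral_mono_AE[OF *])
  also have "\<dots> = ennreal k * modular M p u"
    unfolding modular_def by (subst nn_integral_cmult) auto
  finally show ?thesis .
qed

lemma e2ennreal_epow_cmult_le:
  assumes "0 < E" "0 < r" "E powr r \<le> k"
  shows "e2ennreal (epow \<bar>ereal E * a\<bar> (ereal r)) \<le> ennreal k * e2ennreal (epow \<bar>a\<bar> (ereal r))"
proof (cases a)
  case (real a')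
  have "(E * \<bar>a'\<bar>) powr r = E powr r * \<bar>a'\<bar> powr r" using assms by (simp add: powr_mult)
  also have "\<dots> \<le> k * \<bar>a'\<bar> powr r" using assms by (intro mult_right_mono) auto
  finally have "ennreal ((E * \<bar>a'\<bar>) powr r) \<le> ennreal (k * \<bar>a'\<bar> powr r)" by (rule ennreal_leI)
  also have "\<dots> = ennreal k * ennreal (\<bar>a'\<bar> powr r)"
    using assms by (intro ennreal_mult) (auto intro: order_trans[OF powr_ge_zero])
  finally show ?thesis using real assms by (simp add: abs_mult)
next
  case PInf
  have "0 < k" using assms by (smt (verit) powr_gt_zero)
  then show ?thesis using PInf assms by (simp add: ennreal_mult_top)
next
  case MInf
  have "0 < k" using assms by (smt (verit) powr_gt_zero)
  then show ?thesis using MInf assms by (simp add: ennreal_mult_top)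
qed

lemma modular_dilate:
  assumes "u \<in> borel_measurable M" "p \<in> borel_measurable M"
    and p: "AE x in M. ereal l \<le> p x \<and> p x \<le> ereal L" and "0 < l" "1 \<le> k"
  shows "modular M p (\<lambda>x. ereal k * u x) \<le> ennreal (k powr L) * modular M p u"
proof (rule modular_le_cmult[OF assms(1,2)], use p in eventually_elim)
  case (elim x)
  then obtain r where r: "p x = ereal r" by (cases "p x") auto
  show ?case unfolding r
    using elim r assms by (intro e2ennreal_epow_cmult_le powr_mono) auto
qed

lemma modular_contract:
  assumes "u \<in> borel_measurable M" "p \<in> borel_measurable M"
    and p: "AE x in M. ereal l \<le> p x \<and> p x \<le> ereal L" and "0 < l" "0 < k" "k \<le> 1"
  shows "modular M p (\<lambda>x. ereal k * u x) \<le> ennreal (k powr l) * modular M p u"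
proof (rule modular_le_cmult[OF assms(1,2)], use p in eventually_elim)
  case (elim x)
  then obtain r where r: "p x = ereal r" by (cases "p x") auto
  show ?case unfolding r
    using elim r assms by (intro e2ennreal_epow_cmult_le powr_mono') auto
qed

lemma Lp_norm_le: "0 < r \<Longrightarrow> modular M p (\<lambda>x. u x / ereal r) \<le> 1 \<Longrightarrow> Lp_norm M p u \<le> ennreal r"
  unfolding Lp_norm_def by (intro INF_lower) auto

lemma divide_ereal_mono: "0 < a \<Longrightarrow> a \<le> b \<Longrightarrow> \<bar>x / ereal b\<bar> \<le> \<bar>x / ereal a\<bar>"
  by (cases x) (auto intro!: divide_left_mono)

lemma modular_le_1_if_Lp_norm_less:
  assumes "Lp_norm M p u < ennreal r" "AE x in M. 0 < p x"
  shows "modular M p (\<lambda>x. u x / ereal r) \<le> 1"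
proof -
  obtain a where a: "0 < a" "modular M p (\<lambda>x. u x / ereal a) \<le> 1" "ennreal a < ennreal r"
    using assms(1) unfolding Lp_norm_def INF_less_iff by auto
  then have "a \<le> r" by (metis ennreal_leI leI less_imp_le not_less)
  then have "modular M p (\<lambda>x. u x / ereal r) \<le> modular M p (\<lambda>x. u x / ereal a)"
    using a assms(2) divide_ereal_mono by (intro modular_mono) auto
  then show ?thesis using a by simp
qed

lemma ereal_divide_eq_cmult: "x / ereal r = ereal (1 / r) * x" if "0 < r"
  using that by (cases x) (auto simp: divide_ereal_def divide_inverse mult.commute)

text \<open>
  All exponents are at least \<open>l\<close>, so dividing by \<open>A\<^bsup>1/l\<^esup> \<ge> 1\<close> lowers the modular by a factor
  of at least \<open>A\<close>.
\<close>

lemma Lp_norm_le_if_modular_le: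
  assumes "u \<in> borel_measurable M" "p \<in> borel_measurable M"
    and p: "AE x in M. ereal l \<le> p x \<and> p x \<le> ereal L" and "0 < l" "1 \<le> A" "0 < r"
    and A: "modular M p (\<lambda>x. u x / ereal r) \<le> ennreal A"
  shows "Lp_norm M p u \<le> ennreal (r * A powr (1 / l))"
proof (rule Lp_norm_le)
  let ?k = "A powr (1 / l)"
  have k: "1 \<le> ?k" using assms by (intro ge_one_powr_ge_zero) auto
  then show "0 < r * ?k" using assms by simp
  have m: "(\<lambda>x. u x / ereal r) \<in> borel_measurable M" using assms by measurable
  have "u x / ereal (r * ?k) = ereal (1 / ?k) * (u x / ereal r)" for x
    using k assms by (cases "u x") (auto simp: divide_ereal_def field_simps)
  then have "modular M p (\<lambda>x. u x / ereal (r * ?k)) = modular M p (\<lambda>x. ereal (1 / ?k) * (u x / ereal r))"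
    by simp
  also have "\<dots> \<le> ennreal ((1 / ?k) powr l) * modular M p (\<lambda>x. u x / ereal r)"
    using k by (intro modular_contract[OF m assms(2) p]) (use assms in auto)
  also have "\<dots> \<le> ennreal ((1 / ?k) powr l) * ennreal A"
    using A by (intro mult_left_mono) auto
  also have "\<dots> = ennreal ((1 / ?k) powr l * A)" using assms by (simp add: ennreal_mult)
  also have "(1 / ?k) powr l * A = 1" using assms by (simp add: powr_divide powr_powr)
  finally show "modular M p (\<lambda>x. u x / ereal (r * ?k)) \<le> 1" by simp
qed

lemma Lp_norm_finite:
  assumes u: "u \<in> Lp_space M p" and "p \<in> borel_measurable M"
    and p: "AE x in M. ereal l \<le> p x \<and> p x \<le> ereal L" and "0 < l"
  shows "Lp_norm M p u < \<infinity>"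
proof -
  obtain r :: real where r: "0 < r" "modular M p (\<lambda>x. ereal r * u x) < \<infinity>" and m: "u \<in> borel_measurable M"
    using u by (auto simp: Lp_space_def)
  define A where "A = max 1 (enn2real (modular M p (\<lambda>x. ereal r * u x)))"
  have "u x / ereal (1 / r) = ereal r * u x" for x
    using r by (simp add: ereal_divide_eq_cmult)
  then have "modular M p (\<lambda>x. u x / ereal (1 / r)) = modular M p (\<lambda>x. ereal r * u x)" by simp
  also have "\<dots> = ennreal (enn2real (modular M p (\<lambda>x. ereal r * u x)))" using r by simp
  also have "\<dots> \<le> ennreal A" unfolding A_def by (intro ennreal_leI) simp
  finally have "Lp_norm M p u \<le> ennreal (1 / r * A powr (1 / l))"
    using r by (intro Lp_norm_le_if_modular_le[OF m assms(2-4)]) (auto simp: A_def)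
  then show ?thesis by (simp add: le_less_trans)
qed

section \<open>Almost everywhere bounds for exponents\<close>

lemma ereal_pos_lower:
  assumes "0 < (a :: ereal)"
  obtains l :: real where "0 < l" "l \<le> 1" "ereal l \<le> a"
proof (cases a)
  case (real r)
  then show ?thesis using assms that[of "min r 1"] by auto
next
  case PInf
  then show ?thesis using that[of 1] by auto
qed (use assms in auto)

lemma essinf_AE_le: "AE x in M. essinf M f \<le> f x"
proof -
  have "AE x in M. - f x \<le> esssup M (\<lambda>x. - f x)" by (rule esssup_AE)
  then show ?thesis by eventually_elim (simp add: essinf_def ereal_uminus_le_reorder)
qed

lemma essinf_pos:
  assumes "0 < essinf M f"
  obtains l :: real where "0 < l" "l \<le> 1" "AE x in M. ereal l \<le> f x"
proof -
  obtain l :: real where l: "0 < l" "l \<le> 1" "ereal l \<le> essinf M f" using ereal_pos_lower[OF assms] .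
  have "AE x in M. ereal l \<le> f x" using essinf_AE_le[of M f] l by (auto elim: order_trans)
  then show thesis using that l by blast
qed

lemma exponents_lower:
  assumes "q \<in> exponents M"
  obtains l :: real where "0 < l" "AE x in M. ereal l \<le> q x"
proof -
  have "0 < essinf M q" using assms by (simp add: exponents_def)
  then show thesis by (rule essinf_pos) (rule that)
qed

lemma bounded_exponents_bounds:
  assumes "p \<in> bounded_exponents M"
  obtains l L :: real where "0 < l" "l \<le> 1" "1 \<le> L" "AE x in M. ereal l \<le> p x \<and> p x \<le> ereal L"
proof -
  obtain l :: real where l: "0 < l" "l \<le> 1" "AE x in M. ereal l \<le> p x"
    using assms essinf_pos[of M p] by (auto simp: bounded_exponents_def exponents_def)
  have "esssup M p < \<infinity>" using assms by (auto simp: bounded_exponents_def)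
  then obtain L :: real where L: "esssup M p \<le> ereal L" by (cases "esssup M p") auto
  have L': "esssup M p \<le> ereal (max 1 L)" using L by (rule order_trans) simp
  have "AE x in M. p x \<le> esssup M p" by (rule esssup_AE)
  with l(3) have "AE x in M. ereal l \<le> p x \<and> p x \<le> ereal (max 1 L)"
    by eventually_elim (use L' in \<open>auto elim: order_trans\<close>)
  then show thesis using that[of l "max 1 L"] l by auto
qed

lemma log_exponents_bounds:
  assumes "p \<in> log_exponents M"
  obtains l L C :: real where "0 < l" "l \<le> 1" "1 \<le> L" "AE x in M. ereal l \<le> p x \<and> p x \<le> ereal L"
    "0 < C" "\<And>x y. \<bar>1 / p x - 1 / p y\<bar> \<le> ereal (C / ln (exp 1 + 1 / dist x y))"
proof -
  have "p \<in> bounded_exponents M" using assms by (simp add: log_exponents_def)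
  then obtain l L :: real where "0 < l" "l \<le> 1" "1 \<le> L" "AE x in M. ereal l \<le> p x \<and> p x \<le> ereal L"
    by (rule bounded_exponents_bounds)
  then show thesis using assms that by (auto simp: log_exponents_def)
qed

text \<open>
  Log-Hoelder continuity is a condition on the reciprocal of an exponent, while the smoothness
  enters the estimates as \<open>r\<^bsup>s\<^esup>\<close>. For an exponent bounded by \<open>L\<close> the condition passes from
  \<open>1/s\<close> to \<open>s\<close> by \<open>s - s' = s s' (1/s' - 1/s)\<close>.
\<close>

lemma log_exponent_reciprocal:
  fixes P P' C D L :: real
  assumes "0 < P" "0 < P'" "P \<le> L" "P' \<le> L" "\<bar>1 / ereal P - 1 / ereal P'\<bar> \<le> ereal (C / D)"
  shows "\<bar>1 / P - 1 / P'\<bar> \<le> C / D" "\<bar>P - P'\<bar> \<le> (L * L) * C / D"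
proof -
  show 1: "\<bar>1 / P - 1 / P'\<bar> \<le> C / D" using assms by (simp add: one_ereal_def)
  have "P * P' * (1 / P - 1 / P') = - (P - P')" using assms by (simp add: field_simps)
  then have "\<bar>P - P'\<bar> = P * P' * \<bar>1 / P - 1 / P'\<bar>" using assms by (metis abs_minus_cancel abs_mult abs_of_pos)
  also have "\<dots> \<le> L * L * (C / D)" using 1 assms by (intro mult_mono) auto
  finally show "\<bar>P - P'\<bar> \<le> (L * L) * C / D" by simp
qed

lemma space_eq_UNIV_if_metric_measure_space: "metric_measure_space M \<Longrightarrow> space M = UNIV"
  using sets_eq_imp_space_eq[of M borel] by (simp add: metric_measure_space_def)

lemma emeasure_UNIV_finite:
  fixes M :: "'a::metric_space measure"
  assumes "metric_measure_space M" "totally_bounded (UNIV :: 'a set)"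
  shows "emeasure M UNIV < \<infinity>"
proof -
  obtain k where k: "finite k" "(UNIV :: 'a set) \<subseteq> (\<Union>x\<in>k. ball x 1)"
    using assms(2)[unfolded totally_bounded_metric, rule_format, of 1] unfolding ball_def[symmetric] by auto
  have s: "ball x 1 \<in> sets M" for x :: 'a using assms(1) by (simp add: metric_measure_space_def)
  have "emeasure M UNIV \<le> emeasure M (\<Union>x\<in>k. ball x 1)"
    using k s by (intro emeasure_mono) auto
  also have "\<dots> \<le> (\<Sum>x\<in>k. emeasure M (ball x 1))"
    using k s by (intro emeasure_subadditive_finite) auto
  also have "\<dots> < \<infinity>"
    using k assms(1) by (auto simp: metric_measure_space_def)
  finally show ?thesis .
qed

lemma obtain_sobolev_exponents:
  fixes M :: "'a::metric_space measure"
  assumes M: "metric_measure_space M" "totally_bounded (UNIV :: 'a set)"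
    and Q: "Q \<in> bounded_exponents M" "lower_Ahlfors_regular M Q"
    and p: "p \<in> log_exponents M" and s: "s \<in> log_exponents M" and \<beta>: "\<beta> \<in> bounded_exponents M"
    and sp: "ess_less M (\<lambda>x. s x * p x) Q"
    and \<gamma>: "ess_less M \<beta> (\<lambda>x. Q x * p x / (Q x - s x * p x))"
  obtains P S q B E l L where "sobolev_exponents M P S q B E l L"
    "\<And>x. x \<notin> E \<Longrightarrow> p x = ereal (P x) \<and> s x = ereal (S x) \<and> \<beta> x = ereal (B x)"
proof -
  note space_M = space_eq_UNIV_if_metric_measure_space[OF M(1)]
  obtain lp Lp Cp where p': "0 < lp" "lp \<le> 1" "1 \<le> Lp" "AE x in M. ereal lp \<le> p x \<and> p x \<le> ereal Lp"
    "0 < Cp" "\<And>x y. \<bar>1 / p x - 1 / p y\<bar> \<le> ereal (Cp / ln (exp 1 + 1 / dist x y))"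
    by (rule log_exponents_bounds[OF p]) blast
  obtain ls Ls Cs where s': "0 < ls" "ls \<le> 1" "1 \<le> Ls" "AE x in M. ereal ls \<le> s x \<and> s x \<le> ereal Ls"
    "0 < Cs" "\<And>x y. \<bar>1 / s x - 1 / s y\<bar> \<le> ereal (Cs / ln (exp 1 + 1 / dist x y))"
    by (rule log_exponents_bounds[OF s]) blast
  obtain lb Lb where \<beta>': "0 < lb" "lb \<le> 1" "1 \<le> Lb" "AE x in M. ereal lb \<le> \<beta> x \<and> \<beta> x \<le> ereal Lb"
    by (rule bounded_exponents_bounds[OF \<beta>])
  obtain lQ LQ where Q': "0 < lQ" "lQ \<le> 1" "1 \<le> LQ" "AE x in M. ereal lQ \<le> Q x \<and> Q x \<le> ereal LQ"
    by (rule bounded_exponents_bounds[OF Q(1)])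
  obtain e1 where e1: "0 < e1" "e1 \<le> 1" "AE x in M. ereal e1 \<le> Q x - s x * p x"
    by (rule essinf_pos[OF sp[unfolded ess_less_def]])
  obtain e2 where e2: "0 < e2" "e2 \<le> 1" "AE x in M. ereal e2 \<le> Q x * p x / (Q x - s x * p x) - \<beta> x"
    by (rule essinf_pos[OF \<gamma>[unfolded ess_less_def]])
  obtain b :: real where b: "0 < b" "\<And>x r. 0 < r \<Longrightarrow> r \<le> 1 \<Longrightarrow>
        ereal b * epow (ereal r) (Q x) \<le> enn2ereal (emeasure M (ball x r))"
    using Q(2) unfolding lower_Ahlfors_regular_def by blast
  define l where "l = Min {lp, ls, lb, e1, e2, b, 1}"
  define L where "L = Max {Lp, Ls, Lb, LQ, Cp, Ls * Ls * Cs, 1}"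
  have l: "l \<le> lp" "l \<le> ls" "l \<le> lb" "l \<le> e1" "l \<le> e2" "l \<le> b" "l \<le> 1"
    unfolding l_def by (rule Min_le; simp)+
  have l0: "0 < l"
    using p'(1) s'(1) \<beta>'(1) e1(1) e2(1) b(1) unfolding l_def by simp
  have L: "Lp \<le> L" "Ls \<le> L" "Lb \<le> L" "LQ \<le> L" "Cp \<le> L" "Ls * Ls * Cs \<le> L" "1 \<le> L"
    unfolding L_def by (rule Max_ge; simp)+
  have "AE x in M. (ereal lp \<le> p x \<and> p x \<le> ereal Lp) \<and> (ereal ls \<le> s x \<and> s x \<le> ereal Ls) \<and>
      (ereal lb \<le> \<beta> x \<and> \<beta> x \<le> ereal Lb) \<and> (ereal lQ \<le> Q x \<and> Q x \<le> ereal LQ) \<and>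
      ereal e1 \<le> Q x - s x * p x \<and> ereal e2 \<le> Q x * p x / (Q x - s x * p x) - \<beta> x"
    using p'(4) s'(4) \<beta>'(4) Q'(4) e1(3) e2(3) by (simp only: AE_conj_iff simp_thms)
  then obtain E where E: "E \<in> null_sets M" and *: "\<And>x. x \<notin> E \<Longrightarrow> (ereal lp \<le> p x \<and> p x \<le> ereal Lp) \<and> (ereal ls \<le> s x \<and> s x \<le> ereal Ls) \<and>
      (ereal lb \<le> \<beta> x \<and> \<beta> x \<le> ereal Lb) \<and> (ereal lQ \<le> Q x \<and> Q x \<le> ereal LQ) \<and>
      ereal e1 \<le> Q x - s x * p x \<and> ereal e2 \<le> Q x * p x / (Q x - s x * p x) - \<beta> x"
    by (rule AE_E3) (simp add: space_M)
  define P S q B where "P = (\<lambda>x. real_of_ereal (p x))" and "S = (\<lambda>x. real_of_ereal (s x))"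
    and "q = (\<lambda>x. real_of_ereal (Q x))" and "B = (\<lambda>x. real_of_ereal (\<beta> x))"
  note defs = P_def S_def q_def B_def
  have eq: "p x = ereal (P x)" "s x = ereal (S x)" "Q x = ereal (q x)" "\<beta> x = ereal (B x)" if "x \<notin> E" for x
    using *[OF that] unfolding defs by (cases "p x"; cases "s x"; cases "Q x"; cases "\<beta> x"; simp)+
  have bounds: "lp \<le> P x" "P x \<le> Lp" "ls \<le> S x" "S x \<le> Ls" "lb \<le> B x" "B x \<le> Lb" "q x \<le> LQ"
    "e1 \<le> q x - S x * P x" "e2 \<le> q x * P x / (q x - S x * P x) - B x" if "x \<notin> E" for x
    using *[OF that] eq[OF that] e1(1) by auto
  have D: "0 < ln (exp 1 + 1 / dist x y)" for x y :: 'a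
  proof (rule ln_gt_zero)
    have "1 < exp (1::real)" "0 \<le> 1 / dist x y" by auto
    then show "1 < exp 1 + 1 / dist x y" by linarith
  qed
  have weak: "z \<le> L / ln (exp 1 + 1 / dist x y)" if "z \<le> C / ln (exp 1 + 1 / dist x y)" "C \<le> L" for z C and x y :: 'a
    using that D[of x y] by (meson divide_right_mono less_imp_le order_trans)
  have "sobolev_exponents M P S q B E l L"
  proof
    show "sets M = sets borel" using M by (simp add: metric_measure_space_def)
    show "emeasure M UNIV < \<infinity>" by (rule emeasure_UNIV_finite[OF M])
    show "E \<in> null_sets M" by (rule E)
    show "P \<in> borel_measurable M" unfolding P_def
      using p by (auto simp: log_exponents_def bounded_exponents_def exponents_def)
    show "0 < l" "l \<le> 1" "1 \<le> L" using l0 l L by auto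
    show "l \<le> P x \<and> P x \<le> L" "l \<le> S x \<and> S x \<le> L" "l \<le> B x \<and> B x \<le> L" "q x \<le> L"
      "l \<le> q x - S x * P x" "B x + l \<le> q x * P x / (q x - S x * P x)" if "x \<notin> E" for x
      using bounds[OF that] l L by auto
    show "\<bar>1 / P x - 1 / P y\<bar> \<le> L / ln (exp 1 + 1 / dist x y)" if "x \<notin> E" "y \<notin> E" for x y
      using log_exponent_reciprocal(1)[of "P x" "P y" Lp Cp] bounds[OF that(1)] bounds[OF that(2)]
        p'(1) p'(6)[of x y] eq[OF that(1)] eq[OF that(2)] by (intro weak[OF _ L(5)]) auto
    show "\<bar>S x - S y\<bar> \<le> L / ln (exp 1 + 1 / dist x y)" if "x \<notin> E" "y \<notin> E" for x y
      using log_exponent_reciprocal(2)[of "S x" "S y" Ls Cs] bounds[OF that(1)] bounds[OF that(2)]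
        s'(1) s'(6)[of x y] eq[OF that(1)] eq[OF that(2)] by (intro weak[OF _ L(6)]) auto
    show "ennreal (l * r powr q x) \<le> emeasure M (ball x r)" if "x \<notin> E" "0 < r" "r \<le> 1" for x r
    proof -
      have "e2ennreal (ereal (b * r powr q x)) \<le> emeasure M (ball x r)"
        using b(2)[of r x] b(1) that eq[OF that(1)] by (subst e2ennreal_le_iff) auto
      moreover have "ennreal (l * r powr q x) \<le> ennreal (b * r powr q x)"
        using l by (intro ennreal_leI mult_right_mono) auto
      ultimately show ?thesis by simp
    qed
  qed
  then show thesis using eq by (intro that) auto
qed

section \<open>Compactness for functions with a single gradient\<close>

text \<open>
  Every bounded set in one of the spaces under consideration lies in such a set after a dilation,
  for a suitable constant \<open>c\<close>, where in the last case of the theorem the smoothness \<open>s\<close> is lowered to \<open>t\<close>. It is described by modulars, not by quasi-norms, since the chain argument uses integrals.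
\<close>

definition hajlasz_ball ::
  "'a::metric_space measure \<Rightarrow> ('a \<Rightarrow> ereal) \<Rightarrow> ('a \<Rightarrow> ereal) \<Rightarrow> real \<Rightarrow> ('a \<Rightarrow> ereal) set" where
  "hajlasz_ball M s p c = {u \<in> borel_measurable M. modular M p u \<le> ennreal c \<and>
     (\<exists>g\<in>borel_measurable M. (\<forall>x. 0 \<le> g x) \<and> modular M p g \<le> ennreal c \<and>
       (\<exists>N\<in>null_sets M. \<forall>x\<in>- N. \<forall>y\<in>- N. 0 < dist x y \<and> dist x y < 1 \<longrightarrow>
          \<bar>u x - u y\<bar> \<le> epow (ereal (dist x y)) (s x) * g x + epow (ereal (dist x y)) (s y) * g y))}"

lemma (in sobolev_exponents) hajlasz_ball_real:
  assumes eq: "\<And>x. x \<notin> E \<Longrightarrow> p x = ereal (P x) \<and> s x = ereal (S x)"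
    and p[measurable]: "p \<in> borel_measurable M" and c: "1 \<le> c" and u: "u \<in> hajlasz_ball M s p c"
  obtains U G N where "hajlasz_pair (2 * c) N U G" "AE x in M. u x = ereal (U x)"
proof -
  have [measurable]: "u \<in> borel_measurable M" using u by (simp add: hajlasz_ball_def)
  obtain g N' where g[measurable]: "g \<in> borel_measurable M" and g0: "\<And>x. 0 \<le> g x"
    and mg: "modular M p g \<le> ennreal c" and N': "N' \<in> null_sets M"
    and grad: "\<And>x y. x \<notin> N' \<Longrightarrow> y \<notin> N' \<Longrightarrow> 0 < dist x y \<Longrightarrow> dist x y < 1 \<Longrightarrow>
          \<bar>u x - u y\<bar> \<le> epow (ereal (dist x y)) (s x) * g x + epow (ereal (dist x y)) (s y) * g y"
    using u unfolding hajlasz_ball_def by auto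
  have mu: "modular M p u \<le> ennreal c" using u by (simp add: hajlasz_ball_def)
  have AE_E: "AE x in M. x \<notin> E" using null_E by (rule AE_not_in)
  have pfin: "AE x in M. \<bar>p x\<bar> \<noteq> \<infinity>" using AE_E by eventually_elim (auto simp: eq)
  have "AE x in M. \<bar>u x\<bar> \<noteq> \<infinity>" "AE x in M. \<bar>g x\<bar> \<noteq> \<infinity>"
    using mu mg by (intro AE_finite_if_modular_finite[OF _ p pfin]; auto intro: le_less_trans)+
  then have "AE x in M. \<bar>u x\<bar> \<noteq> \<infinity> \<and> \<bar>g x\<bar> \<noteq> \<infinity> \<and> x \<notin> E \<and> x \<notin> N'"
    using AE_E AE_not_in[OF N'] by eventually_elim auto
  then obtain N where N: "N \<in> null_sets M" and
    *: "\<And>x. x \<notin> N \<Longrightarrow> \<bar>u x\<bar> \<noteq> \<infinity> \<and> \<bar>g x\<bar> \<noteq> \<infinity> \<and> x \<notin> E \<and> x \<notin> N'"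
    by (rule AE_E3) (simp add: space_M)
  define U G where "U = (\<lambda>x. real_of_ereal (u x))" and "G = (\<lambda>x. real_of_ereal (g x))"
  have real: "u x = ereal (U x)" "g x = ereal (G x)" if "x \<notin> N" for x
    using *[OF that] by (auto simp: U_def G_def ereal_real)
  have AE_N: "AE x in M. x \<notin> N" using N by (rule AE_not_in)
  have G0: "0 \<le> G x" for x using g0 by (simp add: G_def real_of_ereal_pos)
  have "hajlasz_pair (2 * c) N U G"
    unfolding hajlasz_pair_def
  proof (intro conjI ballI impI allI)
    show "N \<in> null_sets M" "E \<subseteq> N" using N * by auto
    show "U \<in> borel_measurable M" "G \<in> borel_measurable M" unfolding U_def G_def by measurable
    show "0 \<le> G x" for x by (rule G0)
    have "modular M p u = (\<integral>\<^sup>+x. ennreal (\<bar>U x\<bar> powr P x) \<partial>M)"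
      by (rule modular_cong_real, use AE_N in eventually_elim) (use * eq real in auto)
    moreover have "modular M p g = (\<integral>\<^sup>+x. ennreal (\<bar>G x\<bar> powr P x) \<partial>M)"
      by (rule modular_cong_real, use AE_N in eventually_elim) (use * eq real in auto)
    ultimately have "(\<integral>\<^sup>+x. ennreal (\<bar>U x\<bar> powr P x) \<partial>M) + (\<integral>\<^sup>+x. ennreal (G x powr P x) \<partial>M)
        \<le> ennreal c + ennreal c"
      using mu mg G0 by (intro add_mono) auto
    then show "(\<integral>\<^sup>+x. ennreal (\<bar>U x\<bar> powr P x) \<partial>M) + (\<integral>\<^sup>+x. ennreal (G x powr P x) \<partial>M) \<le> ennreal (2 * c)"
      using c by (simp flip: ennreal_plus)
    show "\<bar>U x - U y\<bar> \<le> dist x y powr S x * G x + dist x y powr S y * G y"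
      if xy: "x \<in> - N" "y \<in> - N" "dist x y < 1" for x y
    proof (cases "x = y")
      case False
      then have "\<bar>u x - u y\<bar> \<le> epow (ereal (dist x y)) (s x) * g x + epow (ereal (dist x y)) (s y) * g y"
        using xy * by (intro grad) auto
      then show ?thesis using xy * eq real by auto
    qed auto
  qed
  moreover have "AE x in M. u x = ereal (U x)" using AE_N real by auto
  ultimately show thesis using that by blast
qed

context sobolev_exponents begin

lemma hajlasz_ball_modular_bounded:
  assumes eq: "\<And>x. x \<notin> E \<Longrightarrow> p x = ereal (P x) \<and> s x = ereal (S x)"
    and \<beta>: "\<And>x. x \<notin> E \<Longrightarrow> \<beta> x = ereal (B x)"
    and p: "p \<in> borel_measurable M" and c: "1 \<le> c"
  obtains D where "1 \<le> D" "\<And>u. u \<in> hajlasz_ball M s p c \<Longrightarrow> modular M \<beta> u \<le> ennreal D"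
proof -
  have "1 \<le> 2 * c" using c by simp
  then obtain D where D: "1 \<le> D"
    "\<And>U G N. hajlasz_pair (2 * c) N U G \<Longrightarrow> (\<integral>\<^sup>+x. ennreal (\<bar>U x\<bar> powr B x) \<partial>M) \<le> ennreal D"
    by (rule hajlasz_bounded) blast
  have "modular M \<beta> u \<le> ennreal D" if u: "u \<in> hajlasz_ball M s p c" for u
  proof -
    obtain U G N where U: "hajlasz_pair (2 * c) N U G" "AE x in M. u x = ereal (U x)"
      using hajlasz_ball_real[OF eq p c u] .
    have "modular M \<beta> u = (\<integral>\<^sup>+x. ennreal (\<bar>U x\<bar> powr B x) \<partial>M)"
      by (rule modular_cong_real, use U(2) AE_not_in[OF null_E] in eventually_elim) (use \<beta> in auto)
    then show ?thesis using D(2)[OF U(1)] by simp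
  qed
  with D(1) show thesis using that by blast
qed

lemma hajlasz_ball_modular_net:
  assumes eq: "\<And>x. x \<notin> E \<Longrightarrow> p x = ereal (P x) \<and> s x = ereal (S x)"
    and \<beta>: "\<And>x. x \<notin> E \<Longrightarrow> \<beta> x = ereal (B x)"
    and p: "p \<in> borel_measurable M" and c: "1 \<le> c"
    and tb: "totally_bounded (UNIV :: 'a set)" and \<eta>: "0 < \<eta>"
  obtains K :: "('a \<Rightarrow> real) set" where "finite K" "\<And>v. v \<in> K \<Longrightarrow> (\<lambda>x. ereal (v x)) \<in> Lp_space M \<beta>"
    "\<And>u. u \<in> hajlasz_ball M s p c \<Longrightarrow> \<exists>v\<in>K. modular M \<beta> (\<lambda>x. u x - ereal (v x)) \<le> ennreal \<eta>"
proof -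
  have "1 \<le> 2 * c" using c by simp
  then obtain K T0 where K: "finite K" "1 \<le> T0"
    "\<And>v. v \<in> K \<Longrightarrow> v \<in> borel_measurable M" "\<And>v x. v \<in> K \<Longrightarrow> \<bar>v x\<bar> \<le> (T0 :: real)"
    "\<And>U G N. hajlasz_pair (2 * c) N U G \<Longrightarrow>
      \<exists>v\<in>K. (\<integral>\<^sup>+x. ennreal (\<bar>U x - v x\<bar> powr B x) \<partial>M) \<le> ennreal \<eta>"
    by (rule hajlasz_finite_net[OF _ tb \<eta>]) blast
  have "(\<lambda>x. ereal (v x)) \<in> Lp_space M \<beta>" if v: "v \<in> K" for v
  proof -
    have AE_E: "AE x in M. x \<notin> E" using null_E by (rule AE_not_in)
    have "modular M \<beta> (\<lambda>x. ereal 1 * ereal (v x)) = (\<integral>\<^sup>+x. ennreal (\<bar>v x\<bar> powr B x) \<partial>M)"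
      by (rule modular_cong_real, use AE_E in eventually_elim) (use \<beta> in auto)
    also have "\<dots> \<le> (\<integral>\<^sup>+x. ennreal (T0 powr L) \<partial>M)"
    proof (rule nn_integral_mono_AE, use AE_E in eventually_elim)
      case (elim x)
      have "\<bar>v x\<bar> powr B x \<le> T0 powr B x"
        using K(4)[OF v] B_bounds[OF elim] l by (intro powr_mono2) auto
      also have "\<dots> \<le> T0 powr L" using B_bounds[OF elim] K(2) by (intro powr_mono) auto
      finally show ?case by (rule ennreal_leI)
    qed
    also have "\<dots> = ennreal (T0 powr L) * emeasure M UNIV" by (simp add: space_M)
    also have "\<dots> < \<infinity>" using finite_M by (simp add: ennreal_mult_less_top)
    finally have "modular M \<beta> (\<lambda>x. ereal 1 * ereal (v x)) < \<infinity>" .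
    moreover have "(\<lambda>x. ereal (v x)) \<in> borel_measurable M" using K(3)[OF v] by measurable
    ultimately show ?thesis unfolding Lp_space_def using zero_less_one by blast
  qed
  moreover have "\<exists>v\<in>K. modular M \<beta> (\<lambda>x. u x - ereal (v x)) \<le> ennreal \<eta>"
    if u: "u \<in> hajlasz_ball M s p c" for u
  proof -
    obtain U G N where U: "hajlasz_pair (2 * c) N U G" "AE x in M. u x = ereal (U x)"
      using hajlasz_ball_real[OF eq p c u] .
    obtain v where v: "v \<in> K" "(\<integral>\<^sup>+x. ennreal (\<bar>U x - v x\<bar> powr B x) \<partial>M) \<le> ennreal \<eta>"
      using K(5)[OF U(1)] by blast
    have "modular M \<beta> (\<lambda>x. u x - ereal (v x)) = (\<integral>\<^sup>+x. ennreal (\<bar>U x - v x\<bar> powr B x) \<partial>M)"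
      by (rule modular_cong_real, use U(2) AE_not_in[OF null_E] in eventually_elim) (use \<beta> in auto)
    with v show ?thesis by (intro bexI[of _ v]) simp_all
  qed
  ultimately show thesis using that K(1) by blast
qed

end

lemma Lp_space_cmult:
  assumes "u \<in> Lp_space M p" "0 < r"
  shows "(\<lambda>x. ereal r * u x) \<in> Lp_space M p"
proof -
  obtain l :: real where l: "0 < l" "modular M p (\<lambda>x. ereal l * u x) < \<infinity>" and [measurable]: "u \<in> borel_measurable M"
    using assms by (auto simp: Lp_space_def)
  have "ereal (l / r) * (ereal r * u x) = ereal l * u x" for x
    using assms(2) by (simp add: mult.assoc[symmetric])
  then have "modular M p (\<lambda>x. ereal (l / r) * (ereal r * u x)) < \<infinity>" using l by simp
  moreover have "0 < l / r" using l assms by simp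
  ultimately show ?thesis unfolding Lp_space_def by (auto simp del: ereal_times)
qed

lemma ennreal_pos_real:
  assumes "0 < (\<epsilon> :: ennreal)"
  obtains e :: real where "0 < e" "ennreal e < \<epsilon>"
proof -
  obtain d where d: "0 < d" "d < \<epsilon>" using dense[OF assms] by blast
  then have "d < \<infinity>" by (simp add: less_top order_less_le_trans top.not_eq_extremum)
  then obtain e where "d = ennreal e" "0 \<le> e" by (cases d) auto
  then show thesis using that d by (metis ennreal_0 less_eq_real_def less_irrefl)
qed

text \<open>
  The assumption on \<open>normY\<close> concerns arbitrary measurable \<open>w\<close>, so it applies to the
  differences \<open>v - u\<close> of elements of \<open>Y\<close>: the inclusion is bounded by homogeneity, and it is continuous at
  every point.
\<close>

lemma compact_embedding_if_hajlasz_ball: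
  fixes M :: "'a::metric_space measure"
  assumes M: "metric_measure_space M" "totally_bounded (UNIV :: 'a set)"
    and Q: "Q \<in> bounded_exponents M" "lower_Ahlfors_regular M Q"
    and p: "p \<in> log_exponents M" and s: "s \<in> log_exponents M" and \<beta>: "\<beta> \<in> bounded_exponents M"
    and sp: "ess_less M (\<lambda>x. s x * p x) Q"
    and \<gamma>: "ess_less M \<beta> (\<lambda>x. Q x * p x / (Q x - s x * p x))"
    and c: "1 \<le> c"
    and Y: "\<And>u. u \<in> Y \<Longrightarrow> u \<in> borel_measurable M \<and> normY u < \<infinity>"
    and ball: "\<And>w \<delta>. w \<in> borel_measurable M \<Longrightarrow> 0 < \<delta> \<Longrightarrow> normY w < ennreal \<delta> \<Longrightarrow>
      (\<lambda>x. w x / ereal \<delta>) \<in> hajlasz_ball M s p c"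
  shows "compact_embedding Y normY (Lp_space M \<beta>) (Lp_norm M \<beta>)"
proof -
  obtain P S q B E l L where "sobolev_exponents M P S q B E l L" and
    eq: "\<And>x. x \<notin> E \<Longrightarrow> p x = ereal (P x) \<and> s x = ereal (S x) \<and> \<beta> x = ereal (B x)"
    by (rule obtain_sobolev_exponents[OF M Q p s \<beta> sp \<gamma>]) blast
  then interpret sobolev_exponents M P S q B E l L by simp
  have pm: "p \<in> borel_measurable M" and \<beta>m: "\<beta> \<in> borel_measurable M"
    using p \<beta> by (auto simp: log_exponents_def bounded_exponents_def exponents_def)
  have eq': "x \<notin> E \<Longrightarrow> p x = ereal (P x) \<and> s x = ereal (S x)" "x \<notin> E \<Longrightarrow> \<beta> x = ereal (B x)" for x
    using eq by auto
  have \<beta>b: "AE x in M. ereal l \<le> \<beta> x \<and> \<beta> x \<le> ereal L"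
    using AE_not_in[OF null_E] by eventually_elim (use eq B_bounds in auto)
  obtain D where D: "1 \<le> D" "\<And>u. u \<in> hajlasz_ball M s p c \<Longrightarrow> modular M \<beta> u \<le> ennreal D"
    by (rule hajlasz_ball_modular_bounded[OF eq' pm c]) auto
  have real_above: "\<exists>\<delta>::real. e \<le> \<delta> \<and> 0 < \<delta> \<and> R < ennreal \<delta>" if "R < \<infinity>" for R :: ennreal and e :: real
  proof (intro exI conjI)
    have "0 < enn2real R + 1" by (intro add_nonneg_pos) auto
    then show pos: "0 < max e (enn2real R + 1)" by (simp only: less_max_iff_disj simp_thms)
    have "R = ennreal (enn2real R)" using that by simp
    also have "\<dots> < ennreal (max e (enn2real R + 1))" using pos by (intro ennreal_lessI) auto
    finally show "R < ennreal (max e (enn2real R + 1))" .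
  qed simp
  have inclusion: "Y \<subseteq> Lp_space M \<beta>"
  proof
    fix u assume u: "u \<in> Y"
    obtain \<delta> where \<delta>: "0 < \<delta>" "normY u < ennreal \<delta>" using real_above Y[OF u] by blast
    have "modular M \<beta> (\<lambda>x. u x / ereal \<delta>) \<le> ennreal D" using Y[OF u] \<delta> by (intro D(2) ball) auto
    moreover have "(\<lambda>x. u x / ereal \<delta>) = (\<lambda>x. ereal (1 / \<delta>) * u x)"
      using \<delta> by (simp add: ereal_divide_eq_cmult)
    ultimately have "modular M \<beta> (\<lambda>x. ereal (1 / \<delta>) * u x) < \<infinity>" by (simp add: le_less_trans)
    moreover have "0 < 1 / \<delta>" using \<delta> by simp
    ultimately show "u \<in> Lp_space M \<beta>" using Y[OF u] unfolding Lp_space_def by blast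
  qed
  have continuity: "\<exists>\<delta>>0. \<forall>v\<in>Y. normY (\<lambda>x. v x - u x) < \<delta> \<longrightarrow> Lp_norm M \<beta> (\<lambda>x. v x - u x) < \<epsilon>"
    if u: "u \<in> Y" and \<epsilon>: "0 < \<epsilon>" for u \<epsilon>
  proof -
    obtain e where e: "0 < e" "ennreal e < \<epsilon>" using ennreal_pos_real[OF \<epsilon>] .
    define A where "A = D powr (1 / l)"
    have A: "0 < A" using D by (simp add: A_def)
    have "Lp_norm M \<beta> (\<lambda>x. v x - u x) < \<epsilon>"
      if v: "v \<in> Y" "normY (\<lambda>x. v x - u x) < ennreal (e / A)" for v
    proof -
      have m: "(\<lambda>x. v x - u x) \<in> borel_measurable M" using Y[OF u] Y[OF v(1)] by (intro borel_measurable_ereal_diff) auto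
      have eA: "0 < e / A" using e A by simp
      have "modular M \<beta> (\<lambda>x. (v x - u x) / ereal (e / A)) \<le> ennreal D"
        by (intro D(2) ball m eA v(2))
      then have "Lp_norm M \<beta> (\<lambda>x. v x - u x) \<le> ennreal (e / A * D powr (1 / l))"
        by (intro Lp_norm_le_if_modular_le[OF m \<beta>m \<beta>b l(1) D(1) eA])
      also have "e / A * D powr (1 / l) = e" using A by (simp add: A_def)
      finally show ?thesis using e by simp
    qed
    then show ?thesis using e A by (intro exI[of _ "ennreal (e / A)"]) simp
  qed
  have net: "\<exists>K. finite K \<and> K \<subseteq> Lp_space M \<beta> \<and> (\<forall>u\<in>F. \<exists>v\<in>K. Lp_norm M \<beta> (\<lambda>x. u x - v x) < \<epsilon>)"
    if F: "F \<subseteq> Y" and R: "R < \<infinity>" "\<forall>u\<in>F. normY u \<le> R" and \<epsilon>: "0 < \<epsilon>" for F R \<epsilon>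
  proof -
    obtain e where e: "0 < e" "ennreal e < \<epsilon>" using ennreal_pos_real[OF \<epsilon>] .
    obtain \<delta> where \<delta>: "e \<le> \<delta>" "0 < \<delta>" "R < ennreal \<delta>" using real_above[OF R(1)] by blast
    \<comment> \<open>dilation by \<open>k = \<delta> / e \<ge> 1\<close> turns the scale \<open>\<delta>\<close> of \<open>F\<close> into the accuracy \<open>e\<close> and
      multiplies modulars by at most \<open>k powr L\<close>, which \<open>\<eta>\<close> compensates\<close>
    define k where "k = \<delta> / e"
    have k: "1 \<le> k" using \<delta> e by (simp add: k_def)
    define \<eta> where "\<eta> = k powr - L"
    have \<eta>: "0 < \<eta>" using k by (simp add: \<eta>_def)
    obtain K :: "('a \<Rightarrow> real) set" where K: "finite K" "\<And>v. v \<in> K \<Longrightarrow> (\<lambda>x. ereal (v x)) \<in> Lp_space M \<beta>"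
      "\<And>u. u \<in> hajlasz_ball M s p c \<Longrightarrow> \<exists>v\<in>K. modular M \<beta> (\<lambda>x. u x - ereal (v x)) \<le> ennreal \<eta>"
      by (rule hajlasz_ball_modular_net[OF eq' pm c M(2) \<eta>]) auto
    define K' where "K' = (\<lambda>v x. ereal \<delta> * ereal (v x)) ` K"
    have "finite K'" "K' \<subseteq> Lp_space M \<beta>"
      unfolding K'_def using K(1,2) \<delta>(2) by (auto intro: Lp_space_cmult simp del: times_ereal.simps)
    moreover have "\<exists>v\<in>K'. Lp_norm M \<beta> (\<lambda>x. u x - v x) < \<epsilon>" if u: "u \<in> F" for u
    proof -
      have um: "u \<in> borel_measurable M" and "normY u < ennreal \<delta>"
        using Y u F R \<delta> by (auto intro: le_less_trans)
      then have "(\<lambda>x. u x / ereal \<delta>) \<in> hajlasz_ball M s p c" using \<delta> by (intro ball)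
      then obtain v where v: "v \<in> K" "modular M \<beta> (\<lambda>x. u x / ereal \<delta> - ereal (v x)) \<le> ennreal \<eta>"
        using K(3) by blast
      have vm: "(\<lambda>x. ereal (v x)) \<in> borel_measurable M" using K(2)[OF v(1)] by (simp add: Lp_space_def)
      have dm: "(\<lambda>x. u x / ereal \<delta> - ereal (v x)) \<in> borel_measurable M"
        using um vm by (intro borel_measurable_ereal_diff borel_measurable_ereal_divide) auto
      have "(u x - ereal \<delta> * ereal (v x)) / ereal e = ereal k * (u x / ereal \<delta> - ereal (v x))" for x
        using e \<delta> by (cases "u x") (auto simp: k_def field_simps)
      then have "modular M \<beta> (\<lambda>x. (u x - ereal \<delta> * ereal (v x)) / ereal e) =
          modular M \<beta> (\<lambda>x. ereal k * (u x / ereal \<delta> - ereal (v x)))" by simp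
      also have "\<dots> \<le> ennreal (k powr L) * modular M \<beta> (\<lambda>x. u x / ereal \<delta> - ereal (v x))"
        by (rule modular_dilate[OF dm \<beta>m \<beta>b l(1) k])
      also have "\<dots> \<le> ennreal (k powr L) * ennreal \<eta>" using v(2) by (rule mult_left_mono) simp
      also have "\<dots> = ennreal (k powr L * \<eta>)" using \<eta> by (simp add: ennreal_mult)
      also have "k powr L * \<eta> = 1" using k by (simp add: \<eta>_def powr_minus)
      finally have "Lp_norm M \<beta> (\<lambda>x. u x - ereal \<delta> * ereal (v x)) \<le> ennreal e"
        using e by (intro Lp_norm_le) auto
      then have "Lp_norm M \<beta> (\<lambda>x. u x - ereal \<delta> * ereal (v x)) < \<epsilon>" using e(2) by (rule le_less_trans)
      moreover have "(\<lambda>x. ereal \<delta> * ereal (v x)) \<in> K'" unfolding K'_def using v(1) by (rule imageI)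
      ultimately show ?thesis by (rule bexI[where x = "\<lambda>x. ereal \<delta> * ereal (v x)"])
    qed
    ultimately show ?thesis by blast
  qed
  show ?thesis unfolding compact_embedding_def
  proof (intro conjI ballI allI impI)
    show "Y \<subseteq> Lp_space M \<beta>" by (rule inclusion)
    show "\<exists>\<delta>>0. \<forall>v\<in>Y. normY (\<lambda>x. v x - u x) < \<delta> \<longrightarrow> Lp_norm M \<beta> (\<lambda>x. v x - u x) < \<epsilon>"
      if "u \<in> Y" "0 < \<epsilon>" for u \<epsilon> using that by (rule continuity)
    fix F and \<epsilon> :: ennreal
    assume F: "F \<subseteq> Y" "\<exists>R<\<infinity>. \<forall>u\<in>F. normY u \<le> R" "0 < \<epsilon>"
    then obtain R where "R < \<infinity>" "\<forall>u\<in>F. normY u \<le> R" by blast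
    with F show "\<exists>K. finite K \<and> K \<subseteq> Lp_space M \<beta> \<and> (\<forall>u\<in>F. \<exists>v\<in>K. Lp_norm M \<beta> (\<lambda>x. u x - v x) < \<epsilon>)"
      by (intro net)
  qed
qed

section \<open>From vector gradients to a single gradient\<close>

lemma dyadic_scale:
  fixes d :: real
  assumes "0 < d" "d < 1"
  obtains n :: nat where "2 powi (- int n - 1) \<le> d" "d < 2 powi (- int n)"
proof -
  obtain k where k: "(1 / 2) ^ k \<le> d" and least: "\<And>j. j < k \<Longrightarrow> \<not> (1 / 2) ^ j \<le> d"
    using real_arch_pow_inv[OF assms(1), of "1 / 2"] exists_least_iff[of "\<lambda>k. (1 / 2) ^ k \<le> d"]
    by (auto simp: less_eq_real_def)
  then obtain n where n: "k = Suc n" using assms by (cases k) auto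
  have "- int n - 1 = - int (Suc n)" by simp
  then have "2 powi (- int n - 1) = (1 / 2 :: real) ^ Suc n"
    by (simp only: power_int_minus power_int_of_nat) (simp add: power_divide inverse_eq_divide)
  moreover have "2 powi (- int n) = (1 / 2 :: real) ^ n"
    by (simp add: power_int_minus power_divide inverse_eq_divide)
  ultimately show thesis using k least[of n] n that[of n] by auto
qed

lemma abs_divide_diff_le: "0 < r \<Longrightarrow> \<bar>a / ereal r - b / ereal r\<bar> \<le> \<bar>a - b\<bar> / ereal r"
  by (cases a; cases b) (auto simp: diff_divide_distrib[symmetric])

text \<open>
  If \<open>d < 2\<^bsup>-n\<^esup>\<close> and \<open>t + e \<le> s\<close>, then \<open>d\<^bsup>s\<^esup> \<le> d\<^bsup>t\<^esup> 2\<^bsup>-en\<^esup>\<close>, so the \<open>n\<close>-th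
  gradient may be damped by \<open>2\<^bsup>-en\<^esup>\<close> at the price of the smaller smoothness \<open>t\<close>. The case
  \<open>e = 0\<close> with \<open>t = s\<close> just collects the gradients in their supremum.
\<close>

lemma hajlasz_ball_if_gradient:
  fixes M :: "'a::metric_space measure"
  assumes M: "metric_measure_space M" and e: "0 \<le> e"
    and st: "AE x in M. \<exists>\<sigma> \<tau>. s x = ereal \<sigma> \<and> t x = ereal \<tau> \<and> \<tau> + e \<le> \<sigma>"
    and w[measurable]: "w \<in> borel_measurable M" and r: "0 < r" and g: "g \<in> vector_gradients M s w"
    and mw: "modular M p (\<lambda>x. w x / ereal r) \<le> ennreal c"
    and mg: "modular M p (\<lambda>x. SUP n. ereal (2 powr - (e * real n)) * (g (int n) x / ereal r)) \<le> ennreal c"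
  shows "(\<lambda>x. w x / ereal r) \<in> hajlasz_ball M t p c"
proof -
  define H where "H x = (SUP n. ereal (2 powr - (e * real n)) * (g (int n) x / ereal r))" for x
  have [measurable]: "g k \<in> borel_measurable M" and g0: "0 \<le> g k x" for k x
    using g by (auto simp: vector_gradients_def)
  note space_M = space_eq_UNIV_if_metric_measure_space[OF M]
  obtain N1 where N1: "N1 \<in> null_sets M" "\<And>x. x \<notin> N1 \<Longrightarrow> \<exists>\<sigma> \<tau>. s x = ereal \<sigma> \<and> t x = ereal \<tau> \<and> \<tau> + e \<le> \<sigma>"
    using st by (rule AE_E3) (simp add: space_M)
  obtain N2 where N2: "N2 \<in> null_sets M" "\<And>k x y. x \<notin> N2 \<Longrightarrow> y \<notin> N2 \<Longrightarrow>
            2 powi (- k - 1) \<le> dist x y \<Longrightarrow> dist x y < 2 powi (- k) \<Longrightarrow>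
            \<bar>w x - w y\<bar> \<le> epow (ereal (dist x y)) (s x) * g k x
                           + epow (ereal (dist x y)) (s y) * g k y"
    using g unfolding vector_gradients_def by blast
  have Hm: "H \<in> borel_measurable M" unfolding H_def by measurable
  have Hge: "ereal (2 powr - (e * real n)) * (g (int n) x / ereal r) \<le> H x" for n x
    unfolding H_def by (intro SUP_upper) auto
  have H0: "0 \<le> H x" for x
    using order_trans[OF _ Hge[of 0 x]] g0 r by (auto intro: ereal_0_le_mult)
  have "\<bar>w x / ereal r - w y / ereal r\<bar> \<le> epow (ereal (dist x y)) (t x) * H x + epow (ereal (dist x y)) (t y) * H y"
    if x: "x \<in> - (N1 \<union> N2)" and y: "y \<in> - (N1 \<union> N2)" and d: "0 < dist x y \<and> dist x y < 1" for x y
  proof -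
    obtain n where n: "2 powi (- int n - 1) \<le> dist x y" "dist x y < 2 powi (- int n)"
      using dyadic_scale d by blast
    have *: "ereal (1 / r) * (epow (ereal (dist x y)) (s z) * g (int n) z) \<le> epow (ereal (dist x y)) (t z) * H z"
      if z: "z \<notin> N1" for z
    proof -
      obtain \<sigma> \<tau> where st: "s z = ereal \<sigma>" "t z = ereal \<tau>" "\<tau> + e \<le> \<sigma>" using N1(2)[OF z] by auto
      have "dist x y powr \<sigma> \<le> dist x y powr (\<tau> + e)" using st d by (intro powr_mono') auto
      also have "\<dots> = dist x y powr \<tau> * dist x y powr e" by (simp add: powr_add)
      also have "\<dots> \<le> dist x y powr \<tau> * 2 powr - (e * real n)"
      proof (intro mult_left_mono)
        have "dist x y \<le> 2 powr - real n"
          using n(2) by (simp add: power_int_minus powr_minus powr_realpow)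
        then have "dist x y powr e \<le> (2 powr - real n) powr e" using e by (intro powr_mono2) auto
        then show "dist x y powr e \<le> 2 powr - (e * real n)" by (simp add: powr_powr mult.commute)
      qed auto
      finally have "ereal (dist x y powr \<sigma>) \<le> ereal (dist x y powr \<tau>) * ereal (2 powr - (e * real n))" by simp
      then have "ereal (dist x y powr \<sigma>) * (g (int n) z / ereal r) \<le>
          ereal (dist x y powr \<tau>) * ereal (2 powr - (e * real n)) * (g (int n) z / ereal r)"
        using g0 r by (intro ereal_mult_right_mono) auto
      also have "\<dots> \<le> ereal (dist x y powr \<tau>) * H z"
        unfolding mult.assoc by (intro ereal_mult_left_mono Hge) auto
      finally show ?thesis using st r by (simp add: ereal_divide_eq_cmult mult_ac)
    qed
    have "\<bar>w x / ereal r - w y / ereal r\<bar> \<le> \<bar>w x - w y\<bar> / ereal r" using r by (rule abs_divide_diff_le)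
    also have "\<dots> = ereal (1 / r) * \<bar>w x - w y\<bar>" using r by (rule ereal_divide_eq_cmult)
    also have "\<dots> \<le> ereal (1 / r) * (epow (ereal (dist x y)) (s x) * g (int n) x
        + epow (ereal (dist x y)) (s y) * g (int n) y)"
      using x y n r by (intro ereal_mult_left_mono N2(2)) auto
    also have "\<dots> = ereal (1 / r) * (epow (ereal (dist x y)) (s x) * g (int n) x)
        + ereal (1 / r) * (epow (ereal (dist x y)) (s y) * g (int n) y)"
      using g0 by (intro ereal_right_distrib ereal_0_le_mult epow_nonneg) auto
    also have "\<dots> \<le> epow (ereal (dist x y)) (t x) * H x + epow (ereal (dist x y)) (t y) * H y"
      using * x y by (intro add_mono) auto
    finally show ?thesis .
  qed
  moreover have "N1 \<union> N2 \<in> null_sets M" using N1 N2 by auto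
  moreover have "modular M p H \<le> ennreal c" using mg unfolding H_def .
  ultimately show ?thesis unfolding hajlasz_ball_def
    using mw Hm H0 by (auto intro!: bexI[of _ H] bexI[of _ "N1 \<union> N2"])
qed

lemma modular_SUP_le:
  assumes [measurable]: "\<And>n. h n \<in> borel_measurable M" "p \<in> borel_measurable M"
    and p: "AE x in M. \<exists>r>0. p x = ereal r" and h: "\<And>n x. 0 \<le> h n x"
  shows "modular M p (\<lambda>x. SUP n::nat. h n x) \<le> (\<Sum>n. modular M p (h n))"
proof -
  have "modular M p (\<lambda>x. SUP n. h n x) \<le> (\<integral>\<^sup>+x. (\<Sum>n. e2ennreal (epow \<bar>h n x\<bar> (p x))) \<partial>M)"
    unfolding modular_def
  proof (rule nn_integral_mono_AE, use p in eventually_elim)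
    case (elim x)
    then obtain r where r: "0 < r" "p x = ereal r" by auto
    define z where "z = (\<Sum>n. e2ennreal (epow \<bar>h n x\<bar> (ereal r)))"
    have "h n x \<le> epow (enn2ereal z) (1 / ereal r)" for n
    proof -
      have "e2ennreal (epow \<bar>h n x\<bar> (ereal r)) \<le> z"
        unfolding z_def using sum_le_suminf[of "\<lambda>n. e2ennreal (epow \<bar>h n x\<bar> (ereal r))" "{n}"]
        by (auto simp: summableI)
      then have "epow (h n x) (ereal r) \<le> enn2ereal z"
        using h by (subst e2ennreal_le_iff[symmetric]) (auto intro: epow_nonneg)
      then show ?thesis
        using h r by (subst epow_le_iff[symmetric]) auto
    qed
    then have "(SUP n. h n x) \<le> epow (enn2ereal z) (1 / ereal r)" by (intro SUP_least)
    moreover have s: "0 \<le> (SUP n. h n x)" using h by (meson SUP_upper2 UNIV_I)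
    ultimately have "epow (SUP n. h n x) (ereal r) \<le> enn2ereal z"
      using r by (subst epow_le_iff) auto
    then have "e2ennreal (epow (SUP n. h n x) (ereal r)) \<le> z"
      using s by (subst e2ennreal_le_iff) (auto intro: epow_nonneg)
    then show ?case using s by (simp add: r z_def)
  qed
  also have "\<dots> = (\<Sum>n. modular M p (h n))"
    unfolding modular_def by (rule nn_integral_suminf) measurable
  finally show ?thesis .
qed

lemma sum_le_infsum_ennreal:
  fixes f :: "'a \<Rightarrow> ennreal"
  assumes "finite A"
  shows "sum f A \<le> infsum f UNIV"
proof -
  have "sum f A = infsum f A" using assms by simp
  also have "\<dots> \<le> infsum f UNIV"
    by (rule infsum_mono_neutral) (auto intro: nonneg_summable_on_complete)
  finally show ?thesis .
qed

lemma suminf_int_le_infsum_ennreal: "(\<Sum>n. f (int n)) \<le> (infsum f UNIV :: ennreal)"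
proof (rule suminf_le_const)
  show "summable (\<lambda>n. f (int n))" by (rule summableI)
  show "(\<Sum>i<n. f (int i)) \<le> infsum f UNIV" for n
    using sum_le_infsum_ennreal[of "int ` {..<n}" f] by (simp add: sum.reindex)
qed

lemma abs_le_lq_norm:
  assumes "0 < q"
  shows "\<bar>a k\<bar> \<le> lq_norm q a"
proof (cases q)
  case (real r)
  have "e2ennreal (epow \<bar>a k\<bar> q) \<le> (\<Sum>\<^sub>\<infinity>k. e2ennreal (epow \<bar>a k\<bar> q))"
    using sum_le_infsum_ennreal[of "{k}" "\<lambda>k. e2ennreal (epow \<bar>a k\<bar> q)"] by simp
  then have "epow \<bar>a k\<bar> q \<le> enn2ereal (\<Sum>\<^sub>\<infinity>k. e2ennreal (epow \<bar>a k\<bar> q))"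
    by (subst e2ennreal_le_iff[symmetric]) (auto intro: epow_nonneg)
  then have "\<bar>a k\<bar> \<le> epow (enn2ereal (\<Sum>\<^sub>\<infinity>k. e2ennreal (epow \<bar>a k\<bar> q))) (1 / q)"
    using assms real by (subst (asm) real, subst (asm) epow_le_iff) auto
  then show ?thesis using real by (simp add: lq_norm_def)
next
  case PInf
  then show ?thesis by (auto simp: lq_norm_def intro: SUP_upper)
qed (use assms in auto)

lemma M_norm_less_hajlasz_ball:
  fixes M :: "'a::metric_space measure"
  assumes M: "metric_measure_space M" and q: "q \<in> exponents M"
    and p: "p \<in> log_exponents M" and s: "s \<in> log_exponents M"
    and w: "w \<in> borel_measurable M" and r: "0 < r" and less: "M_norm M s p q w < ennreal r"
  shows "(\<lambda>x. w x / ereal r) \<in> hajlasz_ball M s p 1"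
proof -
  note space_M = space_eq_UNIV_if_metric_measure_space[OF M]
  have p0: "AE x in M. 0 < p x"
    using p by (auto simp: log_exponents_def bounded_exponents_def exponents_def)
  have q0: "0 < q x" for x using q by (auto simp: exponents_def space_M)
  obtain ls Ls where "0 < ls" and sb: "AE x in M. ereal ls \<le> s x \<and> s x \<le> ereal Ls"
    by (rule log_exponents_bounds[OF s]) blast
  have st: "AE x in M. \<exists>\<sigma> \<tau>. s x = ereal \<sigma> \<and> s x = ereal \<tau> \<and> \<tau> + 0 \<le> \<sigma>"
    using sb
  proof eventually_elim
    case (elim x)
    then show ?case by (cases "s x") auto
  qed
  have "Lp_norm M p w < ennreal r" and "M_seminorm M s p q w < ennreal r"
    using less unfolding M_norm_def by (auto intro: le_less_trans[rotated])
  then obtain g where g: "g \<in> vector_gradients M s w" "Lp_lq_norm M p q g < ennreal r"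
    by (auto simp: M_seminorm_def INF_less_iff)
  have g0: "0 \<le> g k x" for k x using g by (auto simp: vector_gradients_def)
  have mw: "modular M p (\<lambda>x. w x / ereal r) \<le> ennreal 1"
    using modular_le_1_if_Lp_norm_less[OF \<open>Lp_norm M p w < ennreal r\<close> p0] by simp
  have ml: "modular M p (\<lambda>x. lq_norm (q x) (\<lambda>k. g k x) / ereal r) \<le> 1"
    using g(2) unfolding Lp_lq_norm_def by (rule modular_le_1_if_Lp_norm_less[OF _ p0])
  have "\<bar>SUP n. ereal (2 powr - (0 * real n)) * (g (int n) x / ereal r)\<bar>
      \<le> \<bar>lq_norm (q x) (\<lambda>k. g k x) / ereal r\<bar>" for x
  proof -
    have "\<bar>g k x\<bar> / ereal r \<le> lq_norm (q x) (\<lambda>k. g k x) / ereal r" for k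
      using abs_le_lq_norm[OF q0, of "\<lambda>k. g k x" k x] r by (intro ereal_divide_right_mono) auto
    then have "g k x / ereal r \<le> lq_norm (q x) (\<lambda>k. g k x) / ereal r" for k
      using g0 by simp
    then have "(SUP n. g (int n) x / ereal r) \<le> lq_norm (q x) (\<lambda>k. g k x) / ereal r"
      by (intro SUP_least)
    moreover have "0 \<le> (SUP n. g (int n) x / ereal r)"
      using g0 r by (intro SUP_upper2[of 0]) auto
    ultimately show ?thesis by (simp add: one_ereal_def[symmetric] order_trans)
  qed
  then have "modular M p (\<lambda>x. SUP n. ereal (2 powr - (0 * real n)) * (g (int n) x / ereal r))
      \<le> modular M p (\<lambda>x. lq_norm (q x) (\<lambda>k. g k x) / ereal r)"
    by (intro modular_mono p0) auto
  with ml have "modular M p (\<lambda>x. SUP n. ereal (2 powr - (0 * real n)) * (g (int n) x / ereal r)) \<le> ennreal 1"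
    by simp
  then show ?thesis by (intro hajlasz_ball_if_gradient[OF M _ st w r g(1) mw]) auto
qed

text \<open>
  The modular of \<open>\<ell>\<^bsup>q(\<cdot>)\<^esup>(L\<^bsup>p(\<cdot>)\<^esup>)\<close> divides by a weight \<open>a\<^bsup>1/q\<^esup>\<close>, which becomes \<open>a\<^bsup>p/q\<^esup>\<close>
  after taking \<open>p\<close>-th powers. If \<open>a \<le> 1\<close> and \<open>q \<le> p\<close>, this is at most \<open>a\<close>. The range up to 2
  leaves room above 1, as the infimum over all admissible \<open>a\<close> need not be attained.
\<close>

lemma weight_powr_le:
  fixes a r P :: real
  assumes "0 < a" "a \<le> 2" "0 < l" "l \<le> r" "0 < P" "P \<le> L"
  shows "(a powr (1 / r)) powr P \<le> 2 powr (L / l)"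
    and "r \<le> P \<Longrightarrow> (a powr (1 / r)) powr P \<le> 2 powr (L / l) * a"
proof -
  have eq: "(a powr (1 / r)) powr P = a powr (P / r)" by (simp add: powr_powr)
  have L: "0 \<le> L / l" using assms by simp
  have 1: "1 \<le> 2 powr (L / l)" using L by (simp add: ge_one_powr_ge_zero)
  have PL: "P / r \<le> L / l" using assms by (intro frac_le) auto
  have 2: "a powr (P / r) \<le> 2 powr (L / l)"
  proof -
    have "a powr (P / r) \<le> 2 powr (P / r)" using assms by (intro powr_mono2) auto
    also have "\<dots> \<le> 2 powr (L / l)" using PL by simp
    finally show ?thesis .
  qed
  then show "(a powr (1 / r)) powr P \<le> 2 powr (L / l)" by (simp add: eq)
  show "(a powr (1 / r)) powr P \<le> 2 powr (L / l) * a" if "r \<le> P"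
  proof (cases "a \<le> 1")
    case True
    have "a powr (P / r) \<le> a powr 1" using True assms that by (intro powr_mono') auto
    also have "\<dots> \<le> 2 powr (L / l) * a" using 1 assms by simp
    finally show ?thesis by (simp add: eq)
  next
    case False
    then have "2 powr (L / l) * 1 \<le> 2 powr (L / l) * a" by (intro mult_left_mono) auto
    then show ?thesis using 2 unfolding eq by linarith
  qed
qed

lemma modular_le_if_weighted:
  assumes [measurable]: "f \<in> borel_measurable M" "p \<in> borel_measurable M" "q \<in> borel_measurable M"
    and p: "AE x in M. ereal lp \<le> p x \<and> p x \<le> ereal L" "0 < lp" and q: "AE x in M. ereal l \<le> q x" "0 < l"
    and a: "0 < a" "a \<le> 2"
    and f: "modular M p (\<lambda>x. f x / epow (ereal a) (1 / q x)) \<le> 1"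
  shows "modular M p f \<le> ennreal (2 powr (L / l))"
    and "AE x in M. q x \<le> p x \<Longrightarrow> modular M p f \<le> ennreal (2 powr (L / l) * a)"
proof -
  have weight: "modular M p f \<le> ennreal k"
    if k: "AE x in M. \<exists>E r. 0 < E \<and> 0 < r \<and> epow (ereal a) (1 / q x) = ereal E \<and> p x = ereal r \<and> E powr r \<le> k" for k
  proof -
    have "modular M p f \<le> ennreal k * modular M p (\<lambda>x. f x / epow (ereal a) (1 / q x))"
    proof (rule modular_le_cmult, measurable, use k in eventually_elim)
      case (elim x)
      then obtain E r where E: "0 < E" "0 < r" "epow (ereal a) (1 / q x) = ereal E" "p x = ereal r" "E powr r \<le> k"
        by auto
      have "f x = ereal E * (f x / ereal E)"
        using E(1) by (simp add: ereal_divide_eq_cmult mult.assoc[symmetric] one_ereal_def[symmetric])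
      then show ?case
        using e2ennreal_epow_cmult_le[OF E(1,2,5), of "f x / ereal E"] unfolding E by simp
    qed
    also have "\<dots> \<le> ennreal k * 1" using f by (rule mult_left_mono) simp
    finally show ?thesis by simp
  qed
  have L: "0 < L" if "ereal lp \<le> p x" "p x \<le> ereal L" for x
    using order_trans[OF that] p(2) by simp
  show "modular M p f \<le> ennreal (2 powr (L / l))"
  proof (rule weight, use p(1) q(1) in eventually_elim)
    case (elim x)
    then obtain r where r: "p x = ereal r" by (cases "p x") auto
    have r0: "0 < r" "r \<le> L" using elim r p(2) by auto
    show ?case
    proof (cases "q x")
      case (real t)
      then show ?thesis
        using weight_powr_le(1)[OF a q(2) _ r0, of t] elim r r0 a q(2)
        by (intro exI[of _ "a powr (1 / t)"] exI[of _ r]) (auto simp: one_ereal_def)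
    next
      case PInf
      then show ?thesis
        using elim r r0 a q(2)
        by (intro exI[of _ 1] exI[of _ r]) (auto simp: zero_ereal_def ge_one_powr_ge_zero)
    qed (use elim in auto)
  qed
  show "modular M p f \<le> ennreal (2 powr (L / l) * a)" if "AE x in M. q x \<le> p x"
  proof (rule weight, use p(1) q(1) that in eventually_elim)
    case (elim x)
    then obtain r where r: "p x = ereal r" by (cases "p x") auto
    have r0: "0 < r" "r \<le> L" using elim r p(2) by auto
    obtain t where t: "q x = ereal t" using elim r by (cases "q x") auto
    then show ?case
        using weight_powr_le(2)[OF a q(2) _ r0, of t] elim r r0 a q(2)
        by (intro exI[of _ "a powr (1 / t)"] exI[of _ r]) (auto simp: one_ereal_def)
  qed
qed

lemma lq_Lp_norm_lessE:
  assumes "lq_Lp_norm M p q g < ennreal r"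
  obtains m where "0 < m" "m < r" "lq_Lp_modular M p q (\<lambda>k x. g k x / ereal m) \<le> 1"
  using assms unfolding lq_Lp_norm_def INF_less_iff by (auto simp: ennreal_less_iff)

text \<open>
  Each summand of the modular is an infimum of weights and at most 1, so some admissible weight lies
  below 2.
\<close>

lemma lq_Lp_modular_weight:
  assumes "lq_Lp_modular M p q f \<le> 1"
  obtains a :: real where "0 < a" "a \<le> 2" "modular M p (\<lambda>x. f k x / epow (ereal a) (1 / q x)) \<le> 1"
proof -
  let ?A = "\<lambda>k. INF l\<in>{l::real. 0 < l \<and> modular M p (\<lambda>x. f k x / epow (ereal l) (1 / q x)) \<le> 1}. ennreal l"
  have "?A k \<le> infsum ?A UNIV" using sum_le_infsum_ennreal[of "{k}" ?A] by simp
  also have "\<dots> \<le> 1" using assms unfolding lq_Lp_modular_def .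
  also have "1 < ennreal 2" by (simp add: ennreal_less_iff flip: ennreal_1)
  finally obtain a where "0 < a" "modular M p (\<lambda>x. f k x / epow (ereal a) (1 / q x)) \<le> 1" "ennreal a < ennreal 2"
    unfolding INF_less_iff by auto
  then show thesis by (intro that[of a]) (auto simp: ennreal_less_iff)
qed

text \<open>
  The modular of \<open>f k\<close> is at most a constant times every admissible weight, hence at most that
  constant times the infimum of the weights, which is the \<open>k\<close>-th summand.
\<close>

lemma suminf_modular_le_if_lq_Lp_modular:
  assumes fm: "\<And>k. f k \<in> borel_measurable M" and pm: "p \<in> borel_measurable M" and qm: "q \<in> borel_measurable M"
    and p: "AE x in M. ereal lp \<le> p x \<and> p x \<le> ereal L" "0 < lp" and q: "AE x in M. ereal l \<le> q x" "0 < l"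
    and qp: "AE x in M. q x \<le> p x"
    and f: "lq_Lp_modular M p q f \<le> 1"
  shows "(\<Sum>n. modular M p (f (int n))) \<le> ennreal (2 powr (L / l))"
proof -
  define C where "C = 2 powr (L / l)"
  have C: "0 < C" by (simp add: C_def)
  define A where "A k = (INF l\<in>{l::real. 0 < l \<and> modular M p (\<lambda>x. f k x / epow (ereal l) (1 / q x)) \<le> 1}. ennreal l)" for k
  have A1: "infsum A UNIV \<le> 1" using f unfolding lq_Lp_modular_def A_def .
  have "modular M p (f k) \<le> ennreal C * A k" for k
  proof -
    obtain a0 where a0: "0 < a0" "a0 \<le> 2" "modular M p (\<lambda>x. f k x / epow (ereal a0) (1 / q x)) \<le> 1"
      by (rule lq_Lp_modular_weight[OF f])
    have "ennreal (1 / C) * modular M p (f k) \<le> ennreal a"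
      if a: "0 < a" "modular M p (\<lambda>x. f k x / epow (ereal a) (1 / q x)) \<le> 1" for a
    proof -
      have "modular M p (f k) \<le> ennreal (C * a)"
      proof (cases "a \<le> 2")
        case True
        then show ?thesis unfolding C_def
          using modular_le_if_weighted(2)[OF fm pm qm p q a(1) True a(2) qp] by simp
      next
        case False
        \<comment> \<open>a weight \<open>a > 2\<close> exceeds the admissible weight \<open>a0 \<le> 2\<close>\<close>
        have "modular M p (f k) \<le> ennreal (C * a0)" unfolding C_def
          using modular_le_if_weighted(2)[OF fm pm qm p q a0 qp] by simp
        also have "\<dots> \<le> ennreal (C * a)" using C False a0 by (intro ennreal_leI mult_left_mono) auto
        finally show ?thesis .
      qed
      then have "ennreal (1 / C) * modular M p (f k) \<le> ennreal (1 / C) * ennreal (C * a)"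
        by (rule mult_left_mono) simp
      also have "\<dots> = ennreal a" using C a by (simp flip: ennreal_mult)
      finally show ?thesis .
    qed
    then have "ennreal (1 / C) * modular M p (f k) \<le> A k"
      unfolding A_def by (intro INF_greatest) auto
    then have "ennreal C * (ennreal (1 / C) * modular M p (f k)) \<le> ennreal C * A k"
      by (rule mult_left_mono) simp
    moreover have "ennreal C * (ennreal (1 / C) * modular M p (f k)) = modular M p (f k)"
      using C by (simp add: mult.assoc[symmetric] flip: ennreal_mult)
    ultimately show ?thesis by simp
  qed
  then have "(\<Sum>n. modular M p (f (int n))) \<le> (\<Sum>n. ennreal C * A (int n))"
    by (intro suminf_le summableI)
  also have "\<dots> = ennreal C * (\<Sum>n. A (int n))" by simp
  also have "\<dots> \<le> ennreal C * 1"
    using suminf_int_le_infsum_ennreal[of A] A1 by (intro mult_left_mono) auto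
  finally show ?thesis by (simp add: C_def)
qed

lemma N_norm_lessE:
  assumes "N_norm M s p q w < ennreal r" "AE x in M. 0 < p x"
  obtains g m where "g \<in> vector_gradients M s w" "0 < m" "m < r"
    "lq_Lp_modular M p q (\<lambda>k x. g k x / ereal m) \<le> 1" "modular M p (\<lambda>x. w x / ereal r) \<le> 1"
proof -
  have *: "Lp_norm M p w < ennreal r" and "N_seminorm M s p q w < ennreal r"
    using assms(1) unfolding N_norm_def by (auto intro: le_less_trans[rotated])
  then obtain g where g: "g \<in> vector_gradients M s w" "lq_Lp_norm M p q g < ennreal r"
    by (auto simp: N_seminorm_def INF_less_iff)
  then show thesis
    using that modular_le_1_if_Lp_norm_less[OF * assms(2)] by (auto elim: lq_Lp_norm_lessE)
qed

text \<open>
  The modular of the supremum of the gradients is at most the sum of their modulars, which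
  \<open>q \<le> p\<close> compares to the modular of the sequence.
\<close>

lemma N_norm_less_hajlasz_ball_same_smoothness:
  fixes M :: "'a::metric_space measure"
  assumes M: "metric_measure_space M" and q: "q \<in> exponents M"
    and p: "p \<in> log_exponents M" and s: "s \<in> log_exponents M"
    and qp: "AE x in M. q x \<le> p x"
  obtains c where "1 \<le> c" "\<And>w r. w \<in> borel_measurable M \<Longrightarrow> 0 < r \<Longrightarrow> N_norm M s p q w < ennreal r \<Longrightarrow>
    (\<lambda>x. w x / ereal r) \<in> hajlasz_ball M s p c"
proof -
  obtain lp L where lp: "0 < lp" "1 \<le> L" and pb: "AE x in M. ereal lp \<le> p x \<and> p x \<le> ereal L"
    by (rule log_exponents_bounds[OF p]) blast
  obtain l where l: "0 < l" "AE x in M. ereal l \<le> q x"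
    by (rule exponents_lower[OF q]) blast
  obtain ls Ls where sb: "AE x in M. ereal ls \<le> s x \<and> s x \<le> ereal Ls"
    by (rule log_exponents_bounds[OF s]) blast
  have pm: "p \<in> borel_measurable M" and qm: "q \<in> borel_measurable M"
    using p q by (auto simp: log_exponents_def bounded_exponents_def exponents_def)
  have p0: "AE x in M. 0 < p x"
    using p by (auto simp: log_exponents_def bounded_exponents_def exponents_def)
  have preal: "AE x in M. \<exists>r>0. p x = ereal r"
    using pb
  proof eventually_elim
    case (elim x)
    then show ?case using lp by (cases "p x") auto
  qed
  have st: "AE x in M. \<exists>\<sigma> \<tau>. s x = ereal \<sigma> \<and> s x = ereal \<tau> \<and> \<tau> + 0 \<le> \<sigma>"
    using sb
  proof eventually_elim
    case (elim x)
    then show ?case by (cases "s x") auto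
  qed
  define c where "c = 2 powr (L / l)"
  have "0 \<le> L / l" using l lp by simp
  then have c: "1 \<le> c" unfolding c_def by (simp add: ge_one_powr_ge_zero)
  have "(\<lambda>x. w x / ereal r) \<in> hajlasz_ball M s p c"
    if w: "w \<in> borel_measurable M" and r: "0 < r" and less: "N_norm M s p q w < ennreal r" for w r
  proof -
    obtain g m where g: "g \<in> vector_gradients M s w" and m: "0 < m" "m < r"
      and mod: "lq_Lp_modular M p q (\<lambda>k x. g k x / ereal m) \<le> 1" and mw: "modular M p (\<lambda>x. w x / ereal r) \<le> 1"
      using N_norm_lessE[OF less p0] .
    have [measurable]: "g k \<in> borel_measurable M" and g0: "0 \<le> g k x" for k x
      using g by (auto simp: vector_gradients_def)
    have gm: "(\<lambda>x. g k x / ereal m) \<in> borel_measurable M" for k by measurable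
    have gm0: "0 \<le> g k x / ereal m" "0 \<le> g k x / ereal r" for k x using g0 m r by auto
    have gmr: "g k x / ereal r \<le> g k x / ereal m" for k x
      using divide_ereal_mono[of m r "g k x"] m gm0 by simp
    have "modular M p (\<lambda>x. SUP n. ereal (2 powr - (0 * real n)) * (g (int n) x / ereal r))
        \<le> modular M p (\<lambda>x. SUP n. g (int n) x / ereal m)"
    proof (rule modular_mono[OF p0], rule AE_I2)
      fix x
      have "(SUP n. g (int n) x / ereal r) \<le> (SUP n. g (int n) x / ereal m)"
        using gmr by (intro SUP_mono) auto
      moreover have "0 \<le> (SUP n. g (int n) x / ereal r)"
        using gm0 by (intro SUP_upper2[of 0]) auto
      ultimately show "\<bar>SUP n. ereal (2 powr - (0 * real n)) * (g (int n) x / ereal r)\<bar> \<le> \<bar>SUP n. g (int n) x / ereal m\<bar>"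
        by (simp add: one_ereal_def[symmetric] order_trans)
    qed
    also have "\<dots> \<le> (\<Sum>n. modular M p (\<lambda>x. g (int n) x / ereal m))"
      by (rule modular_SUP_le[OF gm pm preal gm0(1)])
    also have "\<dots> \<le> ennreal c"
      unfolding c_def by (rule suminf_modular_le_if_lq_Lp_modular[OF gm pm qm pb lp(1) l(2,1) qp mod])
    finally have mg: "modular M p (\<lambda>x. SUP n. ereal (2 powr - (0 * real n)) * (g (int n) x / ereal r)) \<le> ennreal c" .
    have "modular M p (\<lambda>x. w x / ereal r) \<le> ennreal c"
      using mw c by (metis ennreal_1 ennreal_leI order_trans)
    then show ?thesis by (rule hajlasz_ball_if_gradient[OF M order_refl st w r g _ mg])
  qed
  with c show thesis by (rule that)
qed

text \<open>
  Each single gradient has modular at most \<open>C\<close>. A gap \<open>e\<close> between \<open>t\<close> and \<open>s\<close> damps the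
  \<open>n\<close>-th one by \<open>2\<^bsup>-en\<^esup>\<close>, hence its modular by \<open>z\<^bsup>n\<^esup>\<close> with \<open>z = 2\<^bsup>-e lp\<^esup> < 1\<close>.
\<close>

lemma N_norm_less_hajlasz_ball_smaller_smoothness:
  fixes M :: "'a::metric_space measure"
  assumes M: "metric_measure_space M" and q: "q \<in> exponents M"
    and p: "p \<in> log_exponents M" and s: "s \<in> log_exponents M" and t: "t \<in> log_exponents M"
    and ts: "ess_less M t s"
  obtains c where "1 \<le> c" "\<And>w r. w \<in> borel_measurable M \<Longrightarrow> 0 < r \<Longrightarrow> N_norm M s p q w < ennreal r \<Longrightarrow>
    (\<lambda>x. w x / ereal r) \<in> hajlasz_ball M t p c"
proof -
  obtain lp L where lp: "0 < lp" "1 \<le> L" and pb: "AE x in M. ereal lp \<le> p x \<and> p x \<le> ereal L"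
    by (rule log_exponents_bounds[OF p]) blast
  obtain l where l: "0 < l" "AE x in M. ereal l \<le> q x"
    by (rule exponents_lower[OF q]) blast
  obtain ls Ls where sb: "AE x in M. ereal ls \<le> s x \<and> s x \<le> ereal Ls"
    by (rule log_exponents_bounds[OF s]) blast
  obtain lt Lt where tb: "AE x in M. ereal lt \<le> t x \<and> t x \<le> ereal Lt"
    by (rule log_exponents_bounds[OF t]) blast
  obtain e where e: "0 < e" "AE x in M. ereal e \<le> s x - t x"
    by (rule essinf_pos[OF ts[unfolded ess_less_def]])
  have pm: "p \<in> borel_measurable M" and qm: "q \<in> borel_measurable M"
    using p q by (auto simp: log_exponents_def bounded_exponents_def exponents_def)
  have p0: "AE x in M. 0 < p x"
    using p by (auto simp: log_exponents_def bounded_exponents_def exponents_def)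
  have preal: "AE x in M. \<exists>r>0. p x = ereal r"
    using pb
  proof eventually_elim
    case (elim x)
    then show ?case using lp by (cases "p x") auto
  qed
  have st: "AE x in M. \<exists>\<sigma> \<tau>. s x = ereal \<sigma> \<and> t x = ereal \<tau> \<and> \<tau> + e \<le> \<sigma>"
    using sb tb e(2)
  proof eventually_elim
    case (elim x)
    then show ?case by (cases "s x"; cases "t x") auto
  qed
  define C where "C = 2 powr (L / l)"
  define z where "z = 2 powr - (e * lp)"
  have "0 \<le> L / l" using l lp by simp
  then have C: "1 \<le> C" unfolding C_def by (simp add: ge_one_powr_ge_zero)
  have z: "0 < z" "z < 1" using e lp powr_less_mono[of "- (e * lp)" 0 2] by (auto simp: z_def)
  define c where "c = C * (1 / (1 - z))"
  have "1 * 1 \<le> c" unfolding c_def using C z by (intro mult_mono) auto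
  then have c: "1 \<le> c" by simp
  have "(\<lambda>x. w x / ereal r) \<in> hajlasz_ball M t p c"
    if w: "w \<in> borel_measurable M" and r: "0 < r" and less: "N_norm M s p q w < ennreal r" for w r
  proof -
    obtain g m where g: "g \<in> vector_gradients M s w" and m: "0 < m" "m < r"
      and mod: "lq_Lp_modular M p q (\<lambda>k x. g k x / ereal m) \<le> 1" and mw: "modular M p (\<lambda>x. w x / ereal r) \<le> 1"
      using N_norm_lessE[OF less p0] .
    have [measurable]: "g k \<in> borel_measurable M" and g0: "0 \<le> g k x" for k x
      using g by (auto simp: vector_gradients_def)
    have gm: "(\<lambda>x. g k x / ereal m) \<in> borel_measurable M" "(\<lambda>x. g k x / ereal r) \<in> borel_measurable M"
      "(\<lambda>x. ereal (2 powr - (e * real n)) * (g k x / ereal r)) \<in> borel_measurable M" for k n by measurable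
    have gr: "modular M p (\<lambda>x. g k x / ereal r) \<le> ennreal C" for k
    proof -
      obtain a where a: "0 < a" "a \<le> 2" "modular M p (\<lambda>x. g k x / ereal m / epow (ereal a) (1 / q x)) \<le> 1"
        by (rule lq_Lp_modular_weight[OF mod])
      have "modular M p (\<lambda>x. g k x / ereal r) \<le> modular M p (\<lambda>x. g k x / ereal m)"
        using m divide_ereal_mono[of m r] by (intro modular_mono[OF p0]) auto
      also have "\<dots> \<le> ennreal C"
        unfolding C_def by (rule modular_le_if_weighted(1)[OF gm(1) pm qm pb lp(1) l(2,1) a])
      finally show ?thesis .
    qed
    have "modular M p (\<lambda>x. SUP n. ereal (2 powr - (e * real n)) * (g (int n) x / ereal r))
       \<le> (\<Sum>n. modular M p (\<lambda>x. ereal (2 powr - (e * real n)) * (g (int n) x / ereal r)))"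
      using g0 r by (intro modular_SUP_le[OF gm(3) pm preal] ereal_0_le_mult) auto
    also have "\<dots> \<le> (\<Sum>n. ennreal (C * z ^ n))"
    proof (intro suminf_le summableI)
      fix n
      have k: "0 < 2 powr - (e * real n)" "2 powr - (e * real n) \<le> 1"
        using e powr_mono[of "- (e * real n)" 0 2] by auto
      have "modular M p (\<lambda>x. ereal (2 powr - (e * real n)) * (g (int n) x / ereal r))
          \<le> ennreal ((2 powr - (e * real n)) powr lp) * modular M p (\<lambda>x. g (int n) x / ereal r)"
        by (rule modular_contract[OF gm(2) pm pb lp(1) k])
      also have "\<dots> \<le> ennreal ((2 powr - (e * real n)) powr lp) * ennreal C"
        by (intro mult_left_mono gr) auto
      also have "\<dots> = ennreal ((2 powr - (e * real n)) powr lp * C)" using C by (simp add: ennreal_mult)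
      also have "(2 powr - (e * real n)) powr lp = z ^ n"
        by (simp add: z_def powr_powr powr_realpow[symmetric] mult_ac)
      finally show "modular M p (\<lambda>x. ereal (2 powr - (e * real n)) * (g (int n) x / ereal r)) \<le> ennreal (C * z ^ n)"
        by (simp add: mult.commute)
    qed
    also have "\<dots> = ennreal c"
      unfolding c_def using C z by (intro suminf_ennreal_eq sums_mult geometric_sums) auto
    finally have mg: "modular M p (\<lambda>x. SUP n. ereal (2 powr - (e * real n)) * (g (int n) x / ereal r)) \<le> ennreal c" .
    have "modular M p (\<lambda>x. w x / ereal r) \<le> ennreal c"
      using mw c by (metis ennreal_1 ennreal_leI order_trans)
    then show ?thesis using e(1) by (intro hajlasz_ball_if_gradient[OF M _ st w r g _ mg]) auto
  qed
  with c show thesis by (rule that)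
qed

section \<open>The compact embeddings\<close>

lemma ess_less_smaller_smoothness:
  assumes p: "p \<in> log_exponents M" and s: "s \<in> log_exponents M" and t: "t \<in> log_exponents M"
    and Q: "Q \<in> bounded_exponents M"
    and ts: "ess_less M t s" and sp: "ess_less M (\<lambda>x. s x * p x) Q"
  shows "ess_less M (\<lambda>x. t x * p x) Q"
proof -
  have [measurable]: "p \<in> borel_measurable M" "t \<in> borel_measurable M" "Q \<in> borel_measurable M"
    using p t Q by (auto simp: log_exponents_def bounded_exponents_def exponents_def)
  obtain lp Lp where lp: "0 < lp" and pb: "AE x in M. ereal lp \<le> p x \<and> p x \<le> ereal Lp"
    by (rule log_exponents_bounds[OF p]) blast
  obtain ls Ls where sb: "AE x in M. ereal ls \<le> s x \<and> s x \<le> ereal Ls"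
    by (rule log_exponents_bounds[OF s]) blast
  obtain lt Lt where tb: "AE x in M. ereal lt \<le> t x \<and> t x \<le> ereal Lt"
    by (rule log_exponents_bounds[OF t]) blast
  obtain lQ LQ where Qb: "AE x in M. ereal lQ \<le> Q x \<and> Q x \<le> ereal LQ"
    by (rule bounded_exponents_bounds[OF Q]) blast
  obtain e where e: "0 < e" "AE x in M. ereal e \<le> s x - t x"
    by (rule essinf_pos[OF ts[unfolded ess_less_def]])
  obtain e' where e': "0 < e'" "AE x in M. ereal e' \<le> Q x - s x * p x"
    by (rule essinf_pos[OF sp[unfolded ess_less_def]])
  have "AE x in M. - (Q x - t x * p x) \<le> ereal (- e')"
    using pb sb tb Qb e(2) e'(2)
  proof eventually_elim
    case (elim x)
    then obtain P S T q where eq: "p x = ereal P" "s x = ereal S" "t x = ereal T" "Q x = ereal q"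
      by (cases "p x"; cases "s x"; cases "t x"; cases "Q x") auto
    then have "T * P \<le> S * P" using elim e(1) lp by (intro mult_right_mono) auto
    then show ?case using elim eq by auto
  qed
  then have "esssup M (\<lambda>x. - (Q x - t x * p x)) \<le> ereal (- e')"
    by (intro esssup_I) measurable
  then have "ereal e' \<le> essinf M (\<lambda>x. Q x - t x * p x)"
    unfolding essinf_def by (cases "esssup M (\<lambda>x. - (Q x - t x * p x))") auto
  then show ?thesis using e'(1) unfolding ess_less_def by (simp add: less_le_trans[of 0 "ereal e'"])
qed

lemma Lp_norm_finite_log_exponents:
  assumes "u \<in> Lp_space M p" "p \<in> log_exponents M"
  shows "u \<in> borel_measurable M" "Lp_norm M p u < \<infinity>"
proof -
  obtain lp Lp where "0 < lp" "AE x in M. ereal lp \<le> p x \<and> p x \<le> ereal Lp"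
    by (rule log_exponents_bounds[OF assms(2)]) blast
  moreover have "p \<in> borel_measurable M"
    using assms(2) by (auto simp: log_exponents_def bounded_exponents_def exponents_def)
  ultimately show "Lp_norm M p u < \<infinity>" using assms(1) by (intro Lp_norm_finite)
  show "u \<in> borel_measurable M" using assms(1) by (simp add: Lp_space_def)
qed

theorem theorem3p7:
  fixes M :: "'a::metric_space measure"
    and Q q p s :: "'a \<Rightarrow> ereal"
  assumes "metric_measure_space M"
    and "totally_bounded (UNIV :: 'a set)"
    and "Q \<in> log_exponents M"
    and "lower_Ahlfors_regular M Q"
    and "q \<in> exponents M"
    and "p \<in> log_exponents M"
    and "s \<in> log_exponents M"
    and "ess_less M (\<lambda>x. s x * p x) Q"
  shows
    "(\<forall>\<beta>\<in>bounded_exponents M.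
        (AE x in M. p x \<le> \<beta> x) \<and>
        ess_less M \<beta> (\<lambda>x. Q x * p x / (Q x - s x * p x)) \<longrightarrow>
        compact_embedding (M_space M s p q) (M_norm M s p q) (Lp_space M \<beta>) (Lp_norm M \<beta>)) \<and>
     ((AE x in M. q x \<le> p x) \<longrightarrow>
      (\<forall>\<beta>\<in>bounded_exponents M.
        (AE x in M. p x \<le> \<beta> x) \<and>
        ess_less M \<beta> (\<lambda>x. Q x * p x / (Q x - s x * p x)) \<longrightarrow>
        compact_embedding (N_space M s p q) (N_norm M s p q) (Lp_space M \<beta>) (Lp_norm M \<beta>))) \<and>
     (\<forall>\<beta>\<in>bounded_exponents M. \<forall>t\<in>log_exponents M.
        ess_less M t s \<and>
        (AE x in M. p x \<le> \<beta> x) \<and>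
        ess_less M \<beta> (\<lambda>x. Q x * p x / (Q x - t x * p x)) \<longrightarrow>
        compact_embedding (N_space M s p q) (N_norm M s p q) (Lp_space M \<beta>) (Lp_norm M \<beta>))"
proof (intro conjI ballI impI; (elim conjE)?)
  have Q: "Q \<in> bounded_exponents M" using assms(3) by (simp add: log_exponents_def)
  note embed = compact_embedding_if_hajlasz_ball[OF assms(1,2) Q assms(4,6)]
  have Mfin: "u \<in> borel_measurable M \<and> M_norm M s p q u < \<infinity>" if "u \<in> M_space M s p q" for u
    using that Lp_norm_finite_log_exponents[OF _ assms(6)] by (auto simp: M_space_def M_norm_def)
  have Nfin: "u \<in> borel_measurable M \<and> N_norm M s p q u < \<infinity>" if "u \<in> N_space M s p q" for u
    using that Lp_norm_finite_log_exponents[OF _ assms(6)] by (auto simp: N_space_def N_norm_def)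
  fix \<beta> assume \<beta>: "\<beta> \<in> bounded_exponents M"
  show "compact_embedding (M_space M s p q) (M_norm M s p q) (Lp_space M \<beta>) (Lp_norm M \<beta>)"
    if "ess_less M \<beta> (\<lambda>x. Q x * p x / (Q x - s x * p x))"
    using M_norm_less_hajlasz_ball[OF assms(1,5,6,7)]
    by (intro embed[OF assms(7) \<beta> assms(8) that order_refl Mfin])
  show "compact_embedding (N_space M s p q) (N_norm M s p q) (Lp_space M \<beta>) (Lp_norm M \<beta>)"
    if qp: "AE x in M. q x \<le> p x" and \<gamma>: "ess_less M \<beta> (\<lambda>x. Q x * p x / (Q x - s x * p x))"
  proof -
    obtain c where "1 \<le> c" "\<And>w r. w \<in> borel_measurable M \<Longrightarrow> 0 < r \<Longrightarrow> N_norm M s p q w < ennreal r \<Longrightarrow>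
      (\<lambda>x. w x / ereal r) \<in> hajlasz_ball M s p c"
      using N_norm_less_hajlasz_ball_same_smoothness[OF assms(1,5,6,7) qp] by blast
    then show ?thesis by (intro embed[OF assms(7) \<beta> assms(8) \<gamma> _ Nfin])
  qed
  fix t assume t: "t \<in> log_exponents M"
  show "compact_embedding (N_space M s p q) (N_norm M s p q) (Lp_space M \<beta>) (Lp_norm M \<beta>)"
    if ts: "ess_less M t s" and \<sigma>: "ess_less M \<beta> (\<lambda>x. Q x * p x / (Q x - t x * p x))"
  proof -
    obtain c where "1 \<le> c" "\<And>w r. w \<in> borel_measurable M \<Longrightarrow> 0 < r \<Longrightarrow> N_norm M s p q w < ennreal r \<Longrightarrow>
      (\<lambda>x. w x / ereal r) \<in> hajlasz_ball M t p c"
      using N_norm_less_hajlasz_ball_smaller_smoothness[OF assms(1,5,6,7) t ts] by blast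
    then show ?thesis
      by (intro embed[OF t \<beta> ess_less_smaller_smoothness[OF assms(6,7) t Q ts assms(8)] \<sigma> _ Nfin])
  qed
qed

end
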